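(* Let $G$ be a compact (Hausdorff) group and let $K$ be a closed subgroup of $G$. Then $Pr(\langle x\rangle,G)>0$ for every $x\in K$ if and only if $G$ has an open normal subgroup $T$ such that $K/C_K(T)$ is a torsion group.
   Context: For a closed subgroup $H$ of a compact group $G$, $Pr(H,G)$ denotes the probability that a random element of $H$ commutes with a random element of $G$, i.e. $Pr(H,G)=(\mu_H\times\mu_G)(\{(h,g)\in H\times G: hg=gh\})$, where $\mu_H,\mu_G$ are the normalized Haar measures on $H$ and $G$. For $x\in G$, $\langle x\rangle$ denotes the closed subgroup of $G$ topologically generated by $x$ (the monothetic subgroup generated by $x$). $C_K(T)=\{k\in K: kt=tk \text{ for all } t\in T\}$. *)

theory Defs
  imports "HOL-Analysis.Analysis" "HOL-Algebra.Coset" "HOL-Algebra.Generated_Groups"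
begin

definition compact_group :: "('a, 'b) monoid_scheme \<Rightarrow> 'a topology \<Rightarrow> bool" where
  "compact_group G T \<longleftrightarrow> group G \<and> topspace T = carrier G \<and> compact_space T \<and> Hausdorff_space T
     \<and> continuous_map (prod_topology T T) T (\<lambda>p. fst p \<otimes>\<^bsub>G\<^esub> snd p)
     \<and> continuous_map T T (\<lambda>x. inv\<^bsub>G\<^esub> x)"

definition borel_of :: "'a topology \<Rightarrow> 'a measure" where
  "borel_of T = sigma (topspace T) {U. openin T U}"

text \<open>The (normalized) Haar measure of a closed subgroup H of the compact group (G,T):
a Radon (inner regular on open sets, outer regular) left-invariant Borel probability
measure on H (with the subspace topology).  It exists and is unique.\<close>
definition haar_measure :: "('a, 'b) monoid_scheme \<Rightarrow> 'a topology \<Rightarrow> 'a set \<Rightarrow> 'a measure \<Rightarrow> bool" where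
  "haar_measure G T H \<mu> \<longleftrightarrow>
     emeasure \<mu> H = 1 \<and> space \<mu> = H \<and> sets \<mu> = sets (borel_of (subtopology T H))
     \<and> (\<forall>g\<in>H. \<forall>A\<in>sets \<mu>. emeasure \<mu> ((\<lambda>x. g \<otimes>\<^bsub>G\<^esub> x) ` A) = emeasure \<mu> A)
     \<and> (\<forall>A\<in>sets \<mu>. emeasure \<mu> A = (INF U\<in>{U. openin (subtopology T H) U \<and> A \<subseteq> U}. emeasure \<mu> U))
     \<and> (\<forall>U. openin (subtopology T H) U \<longrightarrow>
            emeasure \<mu> U = (SUP C\<in>{C. compactin (subtopology T H) C \<and> C \<subseteq> U}. emeasure \<mu> C))"

text \<open>Pr(H,G) = (\<mu>_H \<times> \<mu>_G)({(h,g). hg = gh}), written via Fubini as the iterated integral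
of \<mu>_G(C_G(h)) over h in H.\<close>
definition commuting_prob ::
  "('a, 'b) monoid_scheme \<Rightarrow> 'a set \<Rightarrow> 'a measure \<Rightarrow> 'a measure \<Rightarrow> ennreal" where
  "commuting_prob G H \<mu>H \<mu>G =
     (\<integral>\<^sup>+ h. emeasure \<mu>G {g \<in> carrier G. h \<otimes>\<^bsub>G\<^esub> g = g \<otimes>\<^bsub>G\<^esub> h} \<partial>\<mu>H)"

definition monothetic :: "('a, 'b) monoid_scheme \<Rightarrow> 'a topology \<Rightarrow> 'a \<Rightarrow> 'a set" where
  "monothetic G T x = T closure_of (generate G {x})"

definition centralizer_in :: "('a, 'b) monoid_scheme \<Rightarrow> 'a set \<Rightarrow> 'a set \<Rightarrow> 'a set" where
  "centralizer_in G K S = {k \<in> K. \<forall>t\<in>S. k \<otimes>\<^bsub>G\<^esub> t = t \<otimes>\<^bsub>G\<^esub> k}"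

definition torsion_group :: "('a, 'b) monoid_scheme \<Rightarrow> bool" where
  "torsion_group G \<longleftrightarrow> (\<forall>a\<in>carrier G. \<exists>n::nat. n > 0 \<and> a [^]\<^bsub>G\<^esub> n = \<one>\<^bsub>G\<^esub>)"

end

theory Submission
  imports Defs
begin

text \<open>
  Elements with finitely many conjugates form a subgroup \<open>FC\<close>, the union of the closed sets of
  elements with at most \<open>n\<close> conjugates; off \<open>FC\<close> centralizers have measure zero. Hence
  \<open>Pr(\<langle>x\<rangle>, G) > 0\<close> forces \<open>FC \<inter> \<langle>x\<rangle>\<close> to have positive measure in \<open>\<langle>x\<rangle>\<close>, so some power
  of \<open>x\<close> lies in \<open>FC\<close>.

  To find one open normal subgroup for all \<open>x\<close>, let \<open>L\<close> be the closure of \<open>F = FC \<inter> K\<close>. By Baire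
  there are \<open>m\<close>, \<open>n\<close> and a nonempty open \<open>W \<subseteq> L\<close> such that \<open>z\<^sup>m\<close> has at most \<open>n\<close> conjugates for all
  \<open>z \<in> W\<close>. Choose \<open>y \<in> W\<close> maximizing the number of conjugates of \<open>y\<^sup>m\<close>; then for \<open>z\<close> near \<open>y\<close> the
  element \<open>z\<^sup>m\<close> commutes with the whole centralizer of \<open>y\<^sup>m\<close>, hence with its open normal core \<open>N\<close>.
  As \<open>F\<close> is dense in \<open>L\<close>, some \<open>f \<in> F\<close> is near \<open>y\<close>; elements \<open>s\<close> close to the identity commute with \<open>f\<close>,
  so \<open>(f s)\<^sup>m = f\<^sup>m s\<^sup>m\<close> and \<open>s\<^sup>m\<close> centralizes \<open>N\<close>. Finally the powers of any element of \<open>L\<close> return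
  close to the identity.

  The equivalence quantifies over Haar measures, so their existence is needed: a cluster point of the
  normalized covering numbers \<open>(A : U) / (G : U)\<close> is an invariant content, which Caratheodory's
  construction turns into a regular measure.
\<close>

subsection \<open>From contents to regular Borel measures\<close>

lemma sets_borel_of: "sets (borel_of X) = sigma_sets (topspace X) {U. openin X U}"
proof -
  have "{U. openin X U} \<subseteq> Pow (topspace X)"
    by (auto dest: openin_subset)
  then show ?thesis
    by (simp add: borel_of_def sets_measure_of)
qed

lemma openin_imp_sets_borel_of: "openin X U \<Longrightarrow> U \<in> sets (borel_of X)"
  by (simp add: sets_borel_of sigma_sets.Basic)

lemma closedin_imp_sets_borel_of:
  assumes "closedin X C"
  shows "C \<in> sets (borel_of X)"
proof -
  have "topspace X - (topspace X - C) \<in> sets (borel_of X)"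
    using assms unfolding sets_borel_of
    by (intro sigma_sets.Compl sigma_sets.Basic) (auto simp: closedin_def)
  then show ?thesis
    using closedin_subset[OF assms] by (simp add: double_diff)
qed

locale topological_content =
  fixes X :: "'a topology" and c :: "'a set \<Rightarrow> ennreal"
  assumes compact: "compact_space X" and Hausdorff: "Hausdorff_space X"
    and content_empty: "c {} = 0"
    and content_mono: "\<And>C D. closedin X C \<Longrightarrow> closedin X D \<Longrightarrow> C \<subseteq> D \<Longrightarrow> c C \<le> c D"
    and content_Un_le: "\<And>C D. closedin X C \<Longrightarrow> closedin X D \<Longrightarrow> c (C \<union> D) \<le> c C + c D"
    and content_Un_disjoint:
      "\<And>C D. closedin X C \<Longrightarrow> closedin X D \<Longrightarrow> C \<inter> D = {} \<Longrightarrow> c (C \<union> D) = c C + c D"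
begin

definition inner_content :: "'a set \<Rightarrow> ennreal" where
  "inner_content U = (SUP C\<in>{C. closedin X C \<and> C \<subseteq> U}. c C)"

definition outer_content :: "'a set \<Rightarrow> ennreal" where
  "outer_content A = (INF U\<in>{U. openin X U \<and> A \<subseteq> U}. inner_content U)"

lemma content_le_inner: "closedin X C \<Longrightarrow> C \<subseteq> U \<Longrightarrow> c C \<le> inner_content U"
  unfolding inner_content_def by (rule SUP_upper) auto

lemma inner_mono: "U \<subseteq> V \<Longrightarrow> inner_content U \<le> inner_content V"
  unfolding inner_content_def by (rule SUP_subset_mono) auto

lemma outer_mono: "A \<subseteq> B \<Longrightarrow> outer_content A \<le> outer_content B"
  unfolding outer_content_def by (rule INF_superset_mono) auto

lemma outer_le: "openin X U \<Longrightarrow> A \<subseteq> U \<Longrightarrow> outer_content A \<le> inner_content U"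
  unfolding outer_content_def by (rule INF_lower) auto

lemma outer_open: "openin X U \<Longrightarrow> outer_content U = inner_content U"
  by (rule antisym, simp add: outer_le, unfold outer_content_def, rule INF_greatest) (auto intro: inner_mono)

lemma inner_empty: "inner_content {} = 0"
  by (simp add: inner_content_def content_empty cong: conj_cong)

lemma content_finite_cover:
  fixes n :: nat
  assumes "\<And>i. openin X (U i)" "closedin X C" "C \<subseteq> (\<Union>i<n. U i)"
  shows "c C \<le> (\<Sum>i<n. inner_content (U i))"
  using assms(2,3)
proof (induction n arbitrary: C)
  case 0
  then show ?case by (simp add: content_empty)
next
  case (Suc n)
  let ?A = "C - U n" and ?B = "C - (\<Union>i<n. U i)"
  have "closedin X ?A" "closedin X ?B"
    using Suc.prems(1) assms(1) by (auto intro!: closedin_diff)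
  moreover have "disjnt ?A ?B"
    using Suc.prems(2) by (auto simp: disjnt_def lessThan_Suc)
  moreover have "normal_space X"
    using compact Hausdorff compact_Hausdorff_or_regular_imp_normal_space by blast
  ultimately obtain P Q where PQ: "openin X P" "openin X Q" "?A \<subseteq> P" "?B \<subseteq> Q" "disjnt P Q"
    unfolding normal_space_def by metis
  have cl: "closedin X (C - P)" "closedin X (C - Q)"
    using Suc.prems(1) PQ by (auto intro!: closedin_diff)
  have "C = (C - Q) \<union> (C - P)"
    using PQ(5) by (auto simp: disjnt_def)
  then have "c C \<le> c (C - Q) + c (C - P)"
    using content_Un_le[OF cl(2,1)] by simp
  also have "\<dots> \<le> (\<Sum>i<n. inner_content (U i)) + inner_content (U n)"
    using PQ cl by (intro add_mono Suc.IH content_le_inner) auto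
  finally show ?case by simp
qed

lemma inner_countable_subadditive:
  assumes op: "\<And>i::nat. openin X (U i)"
  shows "inner_content (\<Union>i. U i) \<le> (\<Sum>i. inner_content (U i))"
  unfolding inner_content_def[of "\<Union>i. U i"]
proof (rule SUP_least, clarify)
  fix C assume C: "closedin X C" "C \<subseteq> (\<Union>i. U i)"
  have "compactin X C"
    using closedin_compact_space[OF compact C(1)] .
  moreover have "\<And>V. V \<in> range U \<Longrightarrow> openin X V"
    using op by auto
  ultimately obtain \<F> where "finite \<F>" "\<F> \<subseteq> range U" "C \<subseteq> \<Union>\<F>"
    using C(2) unfolding compactin_def by metis
  then obtain I where I: "finite I" "C \<subseteq> (\<Union>i\<in>I. U i)"
    by (metis finite_subset_image)
  then obtain n where "I \<subseteq> {..<n}"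
    using finite_nat_iff_bounded by blast
  then have "c C \<le> (\<Sum>i<n. inner_content (U i))"
    using I(2) by (intro content_finite_cover op C) blast
  also have "\<dots> \<le> (\<Sum>i. inner_content (U i))"
    by (rule sum_le_suminf) auto
  finally show "c C \<le> (\<Sum>i. inner_content (U i))" .
qed

lemma outer_countable_subadditive:
  fixes A :: "nat \<Rightarrow> 'a set"
  assumes sub: "\<And>i. A i \<subseteq> topspace X"
  shows "outer_content (\<Union>i. A i) \<le> (\<Sum>i. outer_content (A i))"
proof (rule ennreal_le_epsilon)
  fix e :: real assume e: "0 < e" and fin: "(\<Sum>i. outer_content (A i)) < Orderings.top"
  have fin_i: "outer_content (A i) < Orderings.top" for i
    using ennreal_suminf_lessD[OF fin] .
  have "\<exists>U. openin X U \<and> A i \<subseteq> U \<and> inner_content U \<le> outer_content (A i) + ennreal (e * (1/2)^Suc i)" for i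
  proof -
    have "outer_content (A i) < outer_content (A i) + ennreal (e * (1/2)^Suc i)"
      using fin_i[of i] e
        ennreal_add_left_cancel_less[of "outer_content (A i)" 0 "ennreal (e * (1/2)^Suc i)"]
      by auto
    then show ?thesis
      unfolding outer_content_def[of "A i"] INF_less_iff by (auto intro: less_imp_le)
  qed
  then obtain U where U: "\<And>i. openin X (U i)" "\<And>i. A i \<subseteq> U i"
      "\<And>i. inner_content (U i) \<le> outer_content (A i) + ennreal (e * (1/2)^Suc i)"
    by metis
  have "outer_content (\<Union>i. A i) \<le> inner_content (\<Union>i. U i)"
    using U(1,2) by (intro outer_le openin_Union) blast+
  also have "\<dots> \<le> (\<Sum>i. inner_content (U i))"
    by (intro inner_countable_subadditive U)
  also have "\<dots> \<le> (\<Sum>i. outer_content (A i) + ennreal (e * (1/2)^Suc i))"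
    by (intro suminf_le U) auto
  also have "\<dots> = (\<Sum>i. outer_content (A i)) + (\<Sum>i. ennreal (e * (1/2)^Suc i))"
    by (intro suminf_add[symmetric]) auto
  also have "(\<Sum>i. ennreal (e * (1/2)^Suc i)) = ennreal e"
    using e sums_mult[OF power_half_series, of e] by (intro suminf_ennreal_eq) auto
  finally show "outer_content (\<Union>i. A i) \<le> (\<Sum>i. outer_content (A i)) + ennreal e" .
qed

lemma outer_measure_space_outer: "outer_measure_space (Pow (topspace X)) outer_content"
  unfolding outer_measure_space_def
proof (intro conjI)
  show "positive (Pow (topspace X)) outer_content"
    using outer_open[OF openin_empty] inner_empty by (simp add: positive_def)
  show "increasing (Pow (topspace X)) outer_content"
    by (simp add: increasing_def outer_mono)
  show "countably_subadditive (Pow (topspace X)) outer_content"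
    unfolding countably_subadditive_def by (auto intro!: outer_countable_subadditive)
qed

lemma inner_split:
  assumes V: "openin X V" and U: "openin X U"
  shows "outer_content (V \<inter> U) + outer_content (V - U) \<le> inner_content V"
proof -
  have "c C + outer_content (V - U) \<le> inner_content V" if C: "closedin X C" "C \<subseteq> V \<inter> U" for C
  proof -
    have "outer_content (V - U) \<le> inner_content (V - C)"
      using V C by (intro outer_le openin_diff) auto
    then have "c C + outer_content (V - U) \<le> c C + inner_content (V - C)"
      by (rule add_left_mono)
    also have "\<dots> = (SUP D\<in>{D. closedin X D \<and> D \<subseteq> V - C}. c C + c D)"
      unfolding inner_content_def using closedin_empty[of X]
      by (subst ennreal_SUP_add_right) (auto simp del: closedin_empty)
    also have "\<dots> \<le> inner_content V"
    proof (rule SUP_least, clarify)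
      fix D assume D: "closedin X D" "D \<subseteq> V - C"
      then have "c C + c D = c (C \<union> D)"
        by (intro content_Un_disjoint[symmetric] C) auto
      also have "\<dots> \<le> inner_content V"
        using C D by (intro content_le_inner closedin_Un) auto
      finally show "c C + c D \<le> inner_content V" .
    qed
    finally show ?thesis .
  qed
  then have "(SUP C\<in>{C. closedin X C \<and> C \<subseteq> V \<inter> U}. c C + outer_content (V - U)) \<le> inner_content V"
    by (intro SUP_least) auto
  also have "(SUP C\<in>{C. closedin X C \<and> C \<subseteq> V \<inter> U}. c C + outer_content (V - U))
      = inner_content (V \<inter> U) + outer_content (V - U)"
    unfolding inner_content_def by (rule ennreal_SUP_add_left) (auto intro: exI[of _ "{}"])
  finally show ?thesis
    by (simp add: outer_open openin_Int V U)
qed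

lemma open_in_lambda_system:
  assumes U: "openin X U"
  shows "U \<in> lambda_system (topspace X) (Pow (topspace X)) outer_content"
proof -
  interpret sigma_algebra "topspace X" "Pow (topspace X)"
    by (rule sigma_algebra_Pow)
  have "outer_content (A \<inter> U) + outer_content (A - U) = outer_content A" if A: "A \<subseteq> topspace X" for A
  proof (rule antisym)
    show "outer_content (A \<inter> U) + outer_content (A - U) \<le> outer_content A"
      unfolding outer_content_def[of A]
    proof (rule INF_greatest, clarify)
      fix V assume V: "openin X V" "A \<subseteq> V"
      have "outer_content (A \<inter> U) + outer_content (A - U) \<le> outer_content (V \<inter> U) + outer_content (V - U)"
        using V by (intro add_mono outer_mono) auto
      also have "\<dots> \<le> inner_content V"
        by (rule inner_split[OF V(1) U])
      finally show "outer_content (A \<inter> U) + outer_content (A - U) \<le> inner_content V" .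
    qed
    have "subadditive (Pow (topspace X)) outer_content"
      using outer_measure_space_outer countably_subadditive_subadditive
      unfolding outer_measure_space_def by blast
    then have "outer_content ((A \<inter> U) \<union> (A - U)) \<le> outer_content (A \<inter> U) + outer_content (A - U)"
      using A by (intro subadditiveD) auto
    then show "outer_content A \<le> outer_content (A \<inter> U) + outer_content (A - U)"
      by (simp add: Int_Diff_Un)
  qed
  then show ?thesis
    using openin_subset[OF U] by (simp add: lambda_system_eq)
qed

theorem regular_measure_exists:
  obtains \<mu> where "space \<mu> = topspace X" "sets \<mu> = sets (borel_of X)"
    "\<And>A. A \<in> sets \<mu> \<Longrightarrow> emeasure \<mu> A = outer_content A"
    "\<And>A. A \<in> sets \<mu> \<Longrightarrow> emeasure \<mu> A = (INF U\<in>{U. openin X U \<and> A \<subseteq> U}. emeasure \<mu> U)"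
    "\<And>U. openin X U \<Longrightarrow> emeasure \<mu> U = (SUP C\<in>{C. compactin X C \<and> C \<subseteq> U}. emeasure \<mu> C)"
proof -
  let ?L = "lambda_system (topspace X) (Pow (topspace X)) outer_content"
  interpret P: sigma_algebra "topspace X" "Pow (topspace X)"
    by (rule sigma_algebra_Pow)
  have L: "measure_space (topspace X) ?L outer_content"
    by (rule P.caratheodory_lemma[OF outer_measure_space_outer])
  then interpret L: sigma_algebra "topspace X" ?L
    by (simp add: measure_space_def)
  let ?S = "sigma_sets (topspace X) {U. openin X U}"
  have "?S \<subseteq> ?L"
    by (intro L.sigma_sets_subset) (auto intro: open_in_lambda_system)
  moreover have S: "sigma_algebra (topspace X) ?S"
    by (intro sigma_algebra_sigma_sets) (auto dest: openin_subset)
  ultimately have ms: "measure_space (topspace X) ?S outer_content"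
    using measure_down[OF L] by blast
  define \<mu> where "\<mu> = measure_of (topspace X) ?S outer_content"
  have sp: "space \<mu> = topspace X"
    unfolding \<mu>_def using S sigma_algebra.space_measure_of_eq by blast
  have se: "sets \<mu> = sets (borel_of X)"
    unfolding \<mu>_def sets_borel_of using S sigma_algebra.sets_measure_of_eq by blast
  have em: "emeasure \<mu> A = outer_content A" if "A \<in> sets \<mu>" for A
    unfolding \<mu>_def using ms that unfolding se sets_borel_of measure_space_def
    by (intro emeasure_measure_of_sigma) auto
  have op: "emeasure \<mu> U = inner_content U" if "openin X U" for U
    using em[of U] outer_open[OF that] openin_imp_sets_borel_of[OF that] se by auto
  have cl: "emeasure \<mu> C = outer_content C" if "closedin X C" for C
    using em[of C] closedin_imp_sets_borel_of[OF that] se by auto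
  have cc: "compactin X C \<longleftrightarrow> closedin X C" for C
    using compact Hausdorff closedin_compact_space compactin_imp_closedin by metis
  show thesis
  proof
    show "emeasure \<mu> A = (INF U\<in>{U. openin X U \<and> A \<subseteq> U}. emeasure \<mu> U)" if "A \<in> sets \<mu>" for A
      using em[OF that] op unfolding outer_content_def by (auto intro!: INF_cong)
    show "emeasure \<mu> U = (SUP C\<in>{C. compactin X C \<and> C \<subseteq> U}. emeasure \<mu> C)" if U: "openin X U" for U
    proof (rule antisym)
      show "emeasure \<mu> U \<le> (SUP C\<in>{C. compactin X C \<and> C \<subseteq> U}. emeasure \<mu> C)"
        unfolding op[OF U] inner_content_def cc
      proof (rule SUP_mono)
        fix C assume "C \<in> {C. closedin X C \<and> C \<subseteq> U}"
        moreover from this have "c C \<le> emeasure \<mu> C"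
          by (auto simp: cl outer_content_def intro!: INF_greatest content_le_inner)
        ultimately show "\<exists>D\<in>{C. closedin X C \<and> C \<subseteq> U}. c C \<le> emeasure \<mu> D"
          by blast
      qed
      show "(SUP C\<in>{C. compactin X C \<and> C \<subseteq> U}. emeasure \<mu> C) \<le> emeasure \<mu> U"
        using openin_imp_sets_borel_of[OF U] se by (intro SUP_least emeasure_mono) auto
    qed
  qed (use sp se em in auto)
qed

end

subsection \<open>Compact groups and covering numbers\<close>

lemma (in group) subgroup_pow_closed: "subgroup H G \<Longrightarrow> x \<in> H \<Longrightarrow> x [^] (n::nat) \<in> H"
  by (induction n) (auto simp: subgroup.one_closed subgroup.m_closed)

locale compact_topological_group =
  fixes G :: "('a, 'b) monoid_scheme" (structure) and T :: "'a topology"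
  assumes compact_group: "compact_group G T"
begin

sublocale group G
  using compact_group by (simp add: compact_group_def)

lemma topspace_eq: "topspace T = carrier G"
  and compact: "compact_space T"
  and Hausdorff: "Hausdorff_space T"
  using compact_group by (auto simp: compact_group_def)

lemma continuous_mult:
  assumes "continuous_map X T f" "continuous_map X T g"
  shows "continuous_map X T (\<lambda>x. f x \<otimes> g x)"
proof -
  have "continuous_map X (prod_topology T T) (\<lambda>x. (f x, g x))"
    using assms by (simp add: continuous_map_pairwise o_def)
  moreover have "continuous_map (prod_topology T T) T (\<lambda>p. fst p \<otimes> snd p)"
    using compact_group by (simp add: compact_group_def)
  ultimately show ?thesis
    using continuous_map_compose by (fastforce simp: o_def)
qed

lemma continuous_inv:
  assumes "continuous_map X T f"
  shows "continuous_map X T (\<lambda>x. inv (f x))"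
  using continuous_map_compose[OF assms, of T "\<lambda>x. inv x"] compact_group
  by (simp add: compact_group_def o_def)

lemma continuous_const: "a \<in> carrier G \<Longrightarrow> continuous_map X T (\<lambda>x. a)"
  by (simp add: topspace_eq)

lemma continuous_pow:
  assumes "continuous_map X T f"
  shows "continuous_map X T (\<lambda>x. f x [^] (n::nat))"
proof (induction n)
  case 0
  then show ?case by (simp add: topspace_eq)
next
  case (Suc n)
  then show ?case using assms by (simp add: continuous_mult)
qed

lemmas continuous_group_intros =
  continuous_mult continuous_inv continuous_const continuous_pow

lemma translate_eq:
  assumes "g \<in> carrier G" "A \<subseteq> carrier G"
  shows "(\<lambda>x. g \<otimes> x) ` A = {x \<in> topspace T. inv g \<otimes> x \<in> A}"
proof
  show "(\<lambda>x. g \<otimes> x) ` A \<subseteq> {x \<in> topspace T. inv g \<otimes> x \<in> A}"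
    using assms by (auto simp: topspace_eq m_assoc[symmetric] subset_iff)
  show "{x \<in> topspace T. inv g \<otimes> x \<in> A} \<subseteq> (\<lambda>x. g \<otimes> x) ` A"
  proof clarify
    fix x assume "x \<in> topspace T" "inv g \<otimes> x \<in> A"
    moreover from this have "x = g \<otimes> (inv g \<otimes> x)"
      using assms by (simp add: topspace_eq m_assoc[symmetric])
    ultimately show "x \<in> (\<lambda>x. g \<otimes> x) ` A" by blast
  qed
qed

lemma openin_translate:
  assumes "g \<in> carrier G" "openin T U"
  shows "openin T ((\<lambda>x. g \<otimes> x) ` U)"
proof -
  have "continuous_map T T (\<lambda>x. inv g \<otimes> x)"
    using assms by (intro continuous_group_intros) (auto simp: continuous_map_id[unfolded id_def])
  then show ?thesis
    using assms openin_subset[OF assms(2)] openin_continuous_map_preimage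
    by (subst translate_eq) (auto simp: topspace_eq[symmetric])
qed

lemma closedin_translate:
  assumes "g \<in> carrier G" "closedin T C"
  shows "closedin T ((\<lambda>x. g \<otimes> x) ` C)"
proof -
  have "continuous_map T T (\<lambda>x. inv g \<otimes> x)"
    using assms by (intro continuous_group_intros) (auto simp: continuous_map_id[unfolded id_def])
  then show ?thesis
    using assms closedin_subset[OF assms(2)] closedin_continuous_map_preimage
    by (subst translate_eq) (auto simp: topspace_eq[symmetric])
qed

lemma translate_translate:
  assumes "g \<in> carrier G" "h \<in> carrier G" "A \<subseteq> carrier G"
  shows "(\<lambda>x. g \<otimes> x) ` (\<lambda>x. h \<otimes> x) ` A = (\<lambda>x. (g \<otimes> h) \<otimes> x) ` A"
  unfolding image_image by (rule image_cong) (use assms in \<open>auto simp: m_assoc subset_iff\<close>)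

lemma translate_inv:
  assumes "g \<in> carrier G" "A \<subseteq> carrier G"
  shows "(\<lambda>x. inv g \<otimes> x) ` (\<lambda>x. g \<otimes> x) ` A = A" "(\<lambda>x. g \<otimes> x) ` (\<lambda>x. inv g \<otimes> x) ` A = A"
proof -
  have "(\<lambda>x. \<one> \<otimes> x) ` A = (\<lambda>x. x) ` A"
    by (rule image_cong) (use assms in auto)
  then show "(\<lambda>x. inv g \<otimes> x) ` (\<lambda>x. g \<otimes> x) ` A = A" "(\<lambda>x. g \<otimes> x) ` (\<lambda>x. inv g \<otimes> x) ` A = A"
    using assms by (simp_all add: translate_translate)
qed

lemma translate_subset: "g \<in> carrier G \<Longrightarrow> A \<subseteq> carrier G \<Longrightarrow> (\<lambda>x. g \<otimes> x) ` A \<subseteq> carrier G"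
  by auto


definition one_nbhd :: "'a set \<Rightarrow> bool" where
  "one_nbhd U \<longleftrightarrow> openin T U \<and> \<one> \<in> U"

definition translate_cover :: "'a set \<Rightarrow> 'a set \<Rightarrow> 'a set \<Rightarrow> bool" where
  "translate_cover U A S \<longleftrightarrow> finite S \<and> S \<subseteq> carrier G \<and> A \<subseteq> (\<Union>s\<in>S. (\<lambda>x. s \<otimes> x) ` U)"

definition covering_number :: "'a set \<Rightarrow> 'a set \<Rightarrow> nat" where
  "covering_number U A = (LEAST n. \<exists>S. translate_cover U A S \<and> card S = n)"

lemma translate_cover_exists:
  assumes U: "one_nbhd U" and A: "A \<subseteq> carrier G"
  shows "\<exists>S. translate_cover U A S"
proof -
  have "compactin T (carrier G)"
    using compact by (simp add: compact_space_def topspace_eq)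
  moreover have "\<And>V. V \<in> (\<lambda>s. (\<lambda>x. s \<otimes> x) ` U) ` carrier G \<Longrightarrow> openin T V"
    using U by (auto simp: one_nbhd_def openin_translate)
  moreover have "carrier G \<subseteq> \<Union>((\<lambda>s. (\<lambda>x. s \<otimes> x) ` U) ` carrier G)"
  proof
    fix g assume g: "g \<in> carrier G"
    then have "g = g \<otimes> \<one>" by simp
    then show "g \<in> \<Union>((\<lambda>s. (\<lambda>x. s \<otimes> x) ` U) ` carrier G)"
      using U g unfolding one_nbhd_def by blast
  qed
  ultimately obtain \<F> where \<F>: "finite \<F>" "\<F> \<subseteq> (\<lambda>s. (\<lambda>x. s \<otimes> x) ` U) ` carrier G"
      "carrier G \<subseteq> \<Union>\<F>"
    unfolding compactin_def by metis
  obtain S where "S \<subseteq> carrier G" "finite S" "\<F> = (\<lambda>s. (\<lambda>x. s \<otimes> x) ` U) ` S"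
    using finite_subset_image[OF \<F>(1,2)] by (elim exE conjE)
  then have "translate_cover U A S"
    using A \<F>(3) by (simp add: translate_cover_def)
  then show ?thesis ..
qed

lemma covering_number_le: "translate_cover U A S \<Longrightarrow> covering_number U A \<le> card S"
  unfolding covering_number_def by (rule Least_le) blast

lemma covering_number_witness:
  assumes "one_nbhd U" "A \<subseteq> carrier G"
  obtains S where "translate_cover U A S" "card S = covering_number U A"
proof -
  have "\<exists>n S. translate_cover U A S \<and> card S = n"
    using translate_cover_exists[OF assms] by blast
  then show thesis
    using LeastI_ex[of "\<lambda>n. \<exists>S. translate_cover U A S \<and> card S = n"] that
    unfolding covering_number_def by blast
qed

lemma covering_number_mono:
  assumes "one_nbhd U" "A \<subseteq> B" "B \<subseteq> carrier G"
  shows "covering_number U A \<le> covering_number U B"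
proof -
  obtain S where S: "translate_cover U B S" "card S = covering_number U B"
    using covering_number_witness assms by metis
  then have "translate_cover U A S"
    using assms(2) unfolding translate_cover_def by blast
  then show ?thesis
    using S covering_number_le by metis
qed

lemma covering_number_Un_le:
  assumes "one_nbhd U" "A \<subseteq> carrier G" "B \<subseteq> carrier G"
  shows "covering_number U (A \<union> B) \<le> covering_number U A + covering_number U B"
proof -
  obtain R S where R: "translate_cover U A R" "card R = covering_number U A"
    and S: "translate_cover U B S" "card S = covering_number U B"
    using covering_number_witness assms by metis
  then have "translate_cover U (A \<union> B) (R \<union> S)"
    unfolding translate_cover_def by blast
  then show ?thesis
    using R(2) S(2) covering_number_le card_Un_le le_trans by metis
qed

lemma covering_number_translate_le:
  assumes U: "one_nbhd U" and A: "A \<subseteq> carrier G" and g: "g \<in> carrier G"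
  shows "covering_number U ((\<lambda>x. g \<otimes> x) ` A) \<le> covering_number U A"
proof -
  have U': "U \<subseteq> carrier G"
    using U openin_subset unfolding one_nbhd_def topspace_eq[symmetric] by blast
  obtain S where S: "translate_cover U A S" "card S = covering_number U A"
    using covering_number_witness assms by metis
  have "(\<lambda>x. g \<otimes> x) ` A \<subseteq> (\<lambda>x. g \<otimes> x) ` (\<Union>s\<in>S. (\<lambda>x. s \<otimes> x) ` U)"
    using S(1) unfolding translate_cover_def by (intro image_mono) blast
  also have "\<dots> = (\<Union>s\<in>S. (\<lambda>x. g \<otimes> s \<otimes> x) ` U)"
    unfolding image_UN using S(1) U' g unfolding translate_cover_def
    by (intro SUP_cong refl translate_translate) auto
  finally have "translate_cover U ((\<lambda>x. g \<otimes> x) ` A) ((\<lambda>s. g \<otimes> s) ` S)"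
    using S(1) g unfolding translate_cover_def by auto
  then have "covering_number U ((\<lambda>x. g \<otimes> x) ` A) \<le> card ((\<lambda>s. g \<otimes> s) ` S)"
    by (rule covering_number_le)
  also have "\<dots> \<le> card S"
    using S(1) unfolding translate_cover_def by (intro card_image_le) auto
  finally show ?thesis
    using S by simp
qed

lemma covering_number_translate:
  assumes U: "one_nbhd U" and A: "A \<subseteq> carrier G" and g: "g \<in> carrier G"
  shows "covering_number U ((\<lambda>x. g \<otimes> x) ` A) = covering_number U A"
  using covering_number_translate_le[OF assms]
    covering_number_translate_le[OF U translate_subset[OF g A], of "inv g"] translate_inv[OF g A] g
  by simp

lemma covering_number_Un_separated:
  assumes U: "one_nbhd U" and A: "A \<subseteq> carrier G" and B: "B \<subseteq> carrier G"
    and sep: "\<And>a b u v. a \<in> A \<Longrightarrow> b \<in> B \<Longrightarrow> u \<in> U \<Longrightarrow> v \<in> U \<Longrightarrow> inv a \<otimes> b \<noteq> inv u \<otimes> v"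
  shows "covering_number U (A \<union> B) = covering_number U A + covering_number U B"
proof (rule antisym)
  have U': "U \<subseteq> carrier G"
    using U openin_subset unfolding one_nbhd_def topspace_eq[symmetric] by blast
  obtain S where S: "translate_cover U (A \<union> B) S" "card S = covering_number U (A \<union> B)"
    using covering_number_witness[OF U] A B by (metis Un_least)
  define SA where "SA = {s \<in> S. (\<lambda>x. s \<otimes> x) ` U \<inter> A \<noteq> {}}"
  define SB where "SB = {s \<in> S. (\<lambda>x. s \<otimes> x) ` U \<inter> B \<noteq> {}}"
  have "translate_cover U A SA" "translate_cover U B SB"
    using S(1) unfolding translate_cover_def SA_def SB_def by fastforce+
  then have "covering_number U A \<le> card SA" "covering_number U B \<le> card SB"
    by (auto intro: covering_number_le)
  moreover have "SA \<inter> SB = {}"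
  proof (rule ccontr)
    assume "SA \<inter> SB \<noteq> {}"
    then obtain s u v where s: "s \<in> S" "u \<in> U" "v \<in> U" "s \<otimes> u \<in> A" "s \<otimes> v \<in> B"
      unfolding SA_def SB_def by blast
    then have "s \<in> carrier G" "u \<in> carrier G" "v \<in> carrier G"
      using S(1) U' unfolding translate_cover_def by auto
    then have "inv (s \<otimes> u) \<otimes> (s \<otimes> v) = inv u \<otimes> v"
      by (simp add: inv_mult_group m_assoc) (simp add: m_assoc[symmetric])
    then show False
      using sep s by metis
  qed
  moreover have "finite S" "SA \<union> SB \<subseteq> S"
    using S(1) unfolding translate_cover_def SA_def SB_def by auto
  ultimately have "covering_number U A + covering_number U B \<le> card S"
    using card_Un_disjoint[of SA SB] card_mono[of S "SA \<union> SB"] finite_subset[of "SA \<union> SB" S]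
    by simp
  then show "covering_number U A + covering_number U B \<le> covering_number U (A \<union> B)"
    using S by simp
  show "covering_number U (A \<union> B) \<le> covering_number U A + covering_number U B"
    by (rule covering_number_Un_le[OF U A B])
qed

lemma covering_number_empty: "covering_number U {} = 0"
  using covering_number_le[of U "{}" "{}"] by (simp add: translate_cover_def)

lemma covering_number_carrier_pos:
  assumes "one_nbhd U"
  shows "0 < covering_number U (carrier G)"
proof -
  obtain S where S: "translate_cover U (carrier G) S" "card S = covering_number U (carrier G)"
    using covering_number_witness[OF assms subset_refl] by blast
  moreover have "S \<noteq> {}"
  proof
    assume "S = {}"
    then have "carrier G \<subseteq> {}"
      using S(1) by (simp add: translate_cover_def)
    then show False
      using one_closed by blast
  qed
  moreover have "finite S"
    using S(1) by (simp add: translate_cover_def)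
  ultimately show ?thesis
    using card_gt_0_iff[of S] by simp
qed

lemma disjoint_closed_separated:
  assumes A: "closedin T A" and B: "closedin T B" and AB: "A \<inter> B = {}"
  obtains U where "one_nbhd U"
    "\<And>a b u v. a \<in> A \<Longrightarrow> b \<in> B \<Longrightarrow> u \<in> U \<Longrightarrow> v \<in> U \<Longrightarrow> inv a \<otimes> b \<noteq> inv u \<otimes> v"
proof -
  have sub: "A \<subseteq> carrier G" "B \<subseteq> carrier G"
    using closedin_subset[OF A] closedin_subset[OF B] by (auto simp: topspace_eq)
  let ?q = "\<lambda>p. inv (fst p) \<otimes> snd p"
  let ?Q = "?q ` (A \<times> B)"
  have cont: "continuous_map (prod_topology T T) T ?q"
    by (intro continuous_mult continuous_inv continuous_map_fst continuous_map_snd)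
  have "compactin (prod_topology T T) (A \<times> B)"
    using A B compact by (auto simp: compactin_Times closedin_compact_space)
  then have "compactin T ?Q"
    by (rule image_compactin[OF _ cont])
  then have Q: "closedin T ?Q"
    using Hausdorff compactin_imp_closedin by blast
  have "\<one> \<notin> ?Q"
  proof
    assume "\<one> \<in> ?Q"
    then obtain a b where ab: "a \<in> A" "b \<in> B" "inv a \<otimes> b = \<one>" by auto
    then have carr: "a \<in> carrier G" "b \<in> carrier G"
      using sub by auto
    then have "b = a \<otimes> (inv a \<otimes> b)"
      by (simp add: m_assoc[symmetric])
    then have "a = b"
      using ab(3) carr by simp
    then show False using ab AB by auto
  qed
  let ?W = "{p \<in> topspace (prod_topology T T). ?q p \<in> carrier G - ?Q}"
  have "openin T (carrier G - ?Q)"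
    using Q by (simp add: closedin_def topspace_eq)
  then have W: "openin (prod_topology T T) ?W"
    by (rule openin_continuous_map_preimage[OF cont])
  have one_W: "(\<one>, \<one>) \<in> ?W"
    using \<open>\<one> \<notin> ?Q\<close> by (simp add: topspace_eq)
  obtain U V where UV: "openin T U" "openin T V" "\<one> \<in> U" "\<one> \<in> V" "U \<times> V \<subseteq> ?W"
    using W[unfolded openin_prod_topology_alt, rule_format, OF one_W] by (elim exE conjE)
  show thesis
  proof
    show "one_nbhd (U \<inter> V)"
      using UV by (auto simp: one_nbhd_def)
    show "inv a \<otimes> b \<noteq> inv u \<otimes> v" if "a \<in> A" "b \<in> B" "u \<in> U \<inter> V" "v \<in> U \<inter> V" for a b u v
    proof
      assume "inv a \<otimes> b = inv u \<otimes> v"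
      then have "inv u \<otimes> v \<in> ?Q"
        using that by (intro image_eqI[of _ _ "(a, b)"]) auto
      moreover have "(u, v) \<in> U \<times> V"
        using that by simp
      then have "(u, v) \<in> ?W"
        by (rule subsetD[OF UV(5)])
      then have "inv u \<otimes> v \<notin> ?Q"
        by (simp only: mem_Collect_eq Diff_iff fst_conv snd_conv not_False_eq_True)
      ultimately show False by contradiction
    qed
  qed
qed

subsection \<open>Existence of Haar measure\<close>

abbreviation set_functions :: "('a set \<Rightarrow> real) topology" where
  "set_functions \<equiv> product_topology (\<lambda>_. top_of_set {0..1}) (Pow (carrier G))"

definition covering_ratio :: "'a set \<Rightarrow> 'a set \<Rightarrow> real" where
  "covering_ratio U = (\<lambda>A\<in>Pow (carrier G). covering_number U A / covering_number U (carrier G))"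

lemma covering_ratio_in_space:
  assumes "one_nbhd U"
  shows "covering_ratio U \<in> topspace set_functions"
  using covering_number_mono[OF assms _ subset_refl] covering_number_carrier_pos[OF assms]
  by (auto simp: covering_ratio_def PiE_iff divide_simps)

lemma one_nbhd_Inter:
  assumes "finite \<U>" "\<And>U. U \<in> \<U> \<Longrightarrow> one_nbhd U"
  obtains U where "one_nbhd U" "\<And>V. V \<in> \<U> \<Longrightarrow> U \<subseteq> V"
proof -
  have "\<exists>U. one_nbhd U \<and> (\<forall>V\<in>\<U>. U \<subseteq> V)"
    using assms
  proof (induction rule: finite_induct)
    case empty
    then show ?case
      by (intro exI[of _ "carrier G"]) (simp add: one_nbhd_def flip: topspace_eq, simp add: topspace_eq)
  next
    case (insert W \<U>)
    then obtain U where "one_nbhd U" "\<forall>V\<in>\<U>. U \<subseteq> V"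
      by auto
    with insert.prems[of W] show ?case
      by (intro exI[of _ "U \<inter> W"]) (auto simp: one_nbhd_def)
  qed
  then show thesis using that by blast
qed

lemma covering_ratio_cluster_point:
  obtains l where "l \<in> topspace set_functions"
    "\<And>\<phi> U. continuous_map set_functions euclideanreal \<phi> \<Longrightarrow> one_nbhd U \<Longrightarrow>
      (\<And>V. one_nbhd V \<Longrightarrow> V \<subseteq> U \<Longrightarrow> 0 \<le> \<phi> (covering_ratio V)) \<Longrightarrow> 0 \<le> \<phi> l"
proof -
  define \<C> where "\<C> = {C. closedin set_functions C \<and>
      (\<exists>U. one_nbhd U \<and> (\<forall>V. one_nbhd V \<and> V \<subseteq> U \<longrightarrow> covering_ratio V \<in> C))}"
  have comp: "compact_space set_functions"
    by (simp add: compact_space_product_topology compact_space_subtopology)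
  have closed: "closedin set_functions C" if "C \<in> \<C>" for C
    using that by (simp add: \<C>_def)
  have fip: "\<Inter>\<F> \<noteq> {}" if \<F>: "finite \<F>" "\<F> \<subseteq> \<C>" for \<F>
  proof -
    have "\<forall>C\<in>\<F>. \<exists>U. one_nbhd U \<and> (\<forall>V. one_nbhd V \<and> V \<subseteq> U \<longrightarrow> covering_ratio V \<in> C)"
      using \<F> by (auto simp: \<C>_def)
    then obtain u where u: "\<forall>C\<in>\<F>. one_nbhd (u C)"
        "\<forall>C\<in>\<F>. \<forall>V. one_nbhd V \<and> V \<subseteq> u C \<longrightarrow> covering_ratio V \<in> C"
      by metis
    obtain U where U: "one_nbhd U" "\<And>V. V \<in> u ` \<F> \<Longrightarrow> U \<subseteq> V"
      using one_nbhd_Inter[of "u ` \<F>"] u(1) \<F>(1) by blast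
    then have "covering_ratio U \<in> \<Inter>\<F>"
      using u(2) by blast
    then show ?thesis by blast
  qed
  have "\<Inter>\<C> \<noteq> {}"
    using compact_space_fip[THEN iffD1, rule_format, OF comp] closed fip by simp
  then obtain l where l: "l \<in> \<Inter>\<C>" by blast
  have top: "topspace set_functions \<in> \<C>"
  proof -
    obtain U where "one_nbhd U"
      using one_nbhd_Inter[of "{}"] by blast
    then show ?thesis
      unfolding \<C>_def using covering_ratio_in_space by (intro CollectI conjI closedin_topspace) metis
  qed
  show thesis
  proof
    show "l \<in> topspace set_functions"
      using l top by blast
    show "0 \<le> \<phi> l"
      if \<phi>: "continuous_map set_functions euclideanreal \<phi>" and U: "one_nbhd U"
        and pos: "\<And>V. one_nbhd V \<Longrightarrow> V \<subseteq> U \<Longrightarrow> 0 \<le> \<phi> (covering_ratio V)" for \<phi> U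
    proof -
      have "closedin set_functions {f \<in> topspace set_functions. \<phi> f \<in> {0..}}"
        by (rule closedin_continuous_map_preimage[OF \<phi>]) auto
      then have "{f \<in> topspace set_functions. \<phi> f \<in> {0..}} \<in> \<C>"
        using U pos covering_ratio_in_space unfolding \<C>_def by blast
      then show ?thesis using l by auto
    qed
  qed
qed

lemma continuous_map_evaluation:
  assumes "A \<subseteq> carrier G"
  shows "continuous_map set_functions euclideanreal (\<lambda>f. f A)"
proof -
  have "continuous_map set_functions (top_of_set {0..1::real}) (\<lambda>f. f A)"
    using assms by (intro continuous_map_product_projection) auto
  then show ?thesis
    by (simp add: continuous_map_in_subtopology)
qed

lemma invariant_content_exists:
  obtains l :: "'a set \<Rightarrow> real"
  where "\<And>A. A \<subseteq> carrier G \<Longrightarrow> 0 \<le> l A" "l {} = 0" "l (carrier G) = 1"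
    "\<And>A B. A \<subseteq> B \<Longrightarrow> B \<subseteq> carrier G \<Longrightarrow> l A \<le> l B"
    "\<And>A B. A \<subseteq> carrier G \<Longrightarrow> B \<subseteq> carrier G \<Longrightarrow> l (A \<union> B) \<le> l A + l B"
    "\<And>A B. closedin T A \<Longrightarrow> closedin T B \<Longrightarrow> A \<inter> B = {} \<Longrightarrow> l (A \<union> B) = l A + l B"
    "\<And>A g. A \<subseteq> carrier G \<Longrightarrow> g \<in> carrier G \<Longrightarrow> l ((\<lambda>x. g \<otimes> x) ` A) = l A"
proof -
  obtain l where l: "l \<in> topspace set_functions"
    and cluster: "\<And>\<phi> U. continuous_map set_functions euclideanreal \<phi> \<Longrightarrow> one_nbhd U \<Longrightarrow>
      (\<And>V. one_nbhd V \<Longrightarrow> V \<subseteq> U \<Longrightarrow> 0 \<le> \<phi> (covering_ratio V)) \<Longrightarrow> 0 \<le> \<phi> l"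
    using covering_ratio_cluster_point by blast
  have cluster_eq: "\<phi> l = 0"
    if \<phi>: "continuous_map set_functions euclideanreal \<phi>" and U: "one_nbhd U"
      and eq: "\<And>V. one_nbhd V \<Longrightarrow> V \<subseteq> U \<Longrightarrow> \<phi> (covering_ratio V) = 0" for \<phi> U
    using cluster[OF \<phi> U] cluster[OF continuous_map_minus[OF \<phi>] U] eq by force
  have G_nbhd: "one_nbhd (carrier G)"
    using openin_topspace[of T] by (simp add: one_nbhd_def topspace_eq)
  note ev = continuous_map_evaluation
  note ratio = covering_ratio_def
  show thesis
  proof
    show "0 \<le> l A" if "A \<subseteq> carrier G" for A
      using l that by (auto simp: PiE_iff)
    show "l {} = 0"
      by (rule cluster_eq[OF ev G_nbhd]) (simp_all add: ratio covering_number_empty)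
    have "l (carrier G) - 1 = 0"
      by (rule cluster_eq[OF continuous_map_diff[OF ev continuous_map_const[THEN iffD2]] G_nbhd])
        (use covering_number_carrier_pos in \<open>auto simp: ratio\<close>)
    then show "l (carrier G) = 1" by simp
    show "l A \<le> l B" if "A \<subseteq> B" "B \<subseteq> carrier G" for A B
    proof -
      have "0 \<le> l B - l A"
        by (rule cluster[OF continuous_map_diff[OF ev ev] G_nbhd])
          (use that covering_number_mono in \<open>auto simp: ratio intro!: divide_right_mono\<close>)
      then show ?thesis by simp
    qed
    show "l (A \<union> B) \<le> l A + l B" if AB: "A \<subseteq> carrier G" "B \<subseteq> carrier G" for A B
    proof -
      have "0 \<le> (l A + l B) - l (A \<union> B)"
      proof (rule cluster[OF continuous_map_diff[OF continuous_map_add[OF ev ev] ev] G_nbhd])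
        fix V assume "one_nbhd V" "V \<subseteq> carrier G"
        then have "real (covering_number V (A \<union> B)) \<le> covering_number V A + covering_number V B"
          using covering_number_Un_le AB of_nat_mono by blast
        then show "0 \<le> covering_ratio V A + covering_ratio V B - covering_ratio V (A \<union> B)"
          using AB by (auto simp: ratio add_divide_distrib[symmetric] intro!: divide_right_mono)
      qed (use AB in auto)
      then show ?thesis by simp
    qed
    show "l (A \<union> B) = l A + l B" if AB: "closedin T A" "closedin T B" "A \<inter> B = {}" for A B
    proof -
      have sub: "A \<subseteq> carrier G" "B \<subseteq> carrier G"
        using closedin_subset[OF AB(1)] closedin_subset[OF AB(2)] by (auto simp: topspace_eq)
      obtain U where U: "one_nbhd U"
        "\<And>a b u v. a \<in> A \<Longrightarrow> b \<in> B \<Longrightarrow> u \<in> U \<Longrightarrow> v \<in> U \<Longrightarrow> inv a \<otimes> b \<noteq> inv u \<otimes> v"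
        using disjoint_closed_separated[OF AB] by blast
      have "(l A + l B) - l (A \<union> B) = 0"
      proof (rule cluster_eq[OF continuous_map_diff[OF continuous_map_add[OF ev ev] ev] U(1)])
        fix V assume V: "one_nbhd V" "V \<subseteq> U"
        have "covering_number V (A \<union> B) = covering_number V A + covering_number V B"
          using U(2) V(2) by (intro covering_number_Un_separated[OF V(1) sub]) blast
        then show "covering_ratio V A + covering_ratio V B - covering_ratio V (A \<union> B) = 0"
          using sub by (auto simp: ratio add_divide_distrib[symmetric])
      qed (use sub in auto)
      then show ?thesis by simp
    qed
    show "l ((\<lambda>x. g \<otimes> x) ` A) = l A" if A: "A \<subseteq> carrier G" and g: "g \<in> carrier G" for A g
    proof -
      have "l ((\<lambda>x. g \<otimes> x) ` A) - l A = 0"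
        by (rule cluster_eq[OF continuous_map_diff[OF ev ev] G_nbhd])
          (use A translate_subset[OF g A] covering_number_translate[OF _ A g] in \<open>auto simp: ratio\<close>)
      then show ?thesis by simp
    qed
  qed
qed

theorem haar_measure_exists: "\<exists>\<mu>. haar_measure G T (carrier G) \<mu>"
proof -
  obtain l :: "'a set \<Rightarrow> real"
    where l: "\<And>A. A \<subseteq> carrier G \<Longrightarrow> 0 \<le> l A" "l {} = 0" "l (carrier G) = 1"
    "\<And>A B. A \<subseteq> B \<Longrightarrow> B \<subseteq> carrier G \<Longrightarrow> l A \<le> l B"
    "\<And>A B. A \<subseteq> carrier G \<Longrightarrow> B \<subseteq> carrier G \<Longrightarrow> l (A \<union> B) \<le> l A + l B"
    "\<And>A B. closedin T A \<Longrightarrow> closedin T B \<Longrightarrow> A \<inter> B = {} \<Longrightarrow> l (A \<union> B) = l A + l B"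
    "\<And>A g. A \<subseteq> carrier G \<Longrightarrow> g \<in> carrier G \<Longrightarrow> l ((\<lambda>x. g \<otimes> x) ` A) = l A"
    using invariant_content_exists by blast
  have cl: "C \<subseteq> carrier G" if "closedin T C" for C
    using closedin_subset[OF that] by (simp add: topspace_eq)
  interpret topological_content T "\<lambda>A. ennreal (l A)"
  proof
    show "compact_space T" "Hausdorff_space T"
      by (rule compact, rule Hausdorff)
    show "ennreal (l {}) = 0"
      by (simp add: l(2))
    show "ennreal (l C) \<le> ennreal (l D)" if "closedin T C" "closedin T D" "C \<subseteq> D" for C D
      using that by (intro ennreal_leI l(4) cl)
    show "ennreal (l (C \<union> D)) \<le> ennreal (l C) + ennreal (l D)"
      if "closedin T C" "closedin T D" for C D
      using l(5)[OF cl cl] l(1)[OF cl] that by (simp add: ennreal_leI flip: ennreal_plus)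
    show "ennreal (l (C \<union> D)) = ennreal (l C) + ennreal (l D)"
      if "closedin T C" "closedin T D" "C \<inter> D = {}" for C D
      using l(6) l(1)[OF cl] that by simp
  qed
  have inner_le: "inner_content U \<le> inner_content ((\<lambda>x. g \<otimes> x) ` U)"
    if g: "g \<in> carrier G" for g U
    unfolding inner_content_def[of U]
  proof (rule SUP_least, clarify)
    fix C assume C: "closedin T C" "C \<subseteq> U"
    have "ennreal (l C) = ennreal (l ((\<lambda>x. g \<otimes> x) ` C))"
      using l(7)[OF cl[OF C(1)] g] by simp
    also have "\<dots> \<le> inner_content ((\<lambda>x. g \<otimes> x) ` U)"
      using C g by (intro content_le_inner closedin_translate image_mono) auto
    finally show "ennreal (l C) \<le> inner_content ((\<lambda>x. g \<otimes> x) ` U)" .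
  qed
  have outer_le: "outer_content A \<le> outer_content ((\<lambda>x. g \<otimes> x) ` A)"
    if g: "g \<in> carrier G" and A: "A \<subseteq> carrier G" for g A
    unfolding outer_content_def[of "(\<lambda>x. g \<otimes> x) ` A"]
  proof (rule INF_greatest, clarify)
    fix V assume V: "openin T V" "(\<lambda>x. g \<otimes> x) ` A \<subseteq> V"
    have V': "V \<subseteq> carrier G"
      using openin_subset[OF V(1)] by (simp add: topspace_eq)
    have "A \<subseteq> (\<lambda>x. inv g \<otimes> x) ` V"
      using image_mono[OF V(2), of "\<lambda>x. inv g \<otimes> x"] translate_inv(1)[OF g A] by simp
    then have "outer_content A \<le> inner_content ((\<lambda>x. inv g \<otimes> x) ` V)"
      using g V(1) by (intro outer_le openin_translate) auto
    also have "\<dots> \<le> inner_content ((\<lambda>x. g \<otimes> x) ` (\<lambda>x. inv g \<otimes> x) ` V)"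
      by (rule inner_le[OF g])
    finally show "outer_content A \<le> inner_content V"
      by (simp only: translate_inv(2)[OF g V'])
  qed
  have outer_eq: "outer_content ((\<lambda>x. g \<otimes> x) ` A) = outer_content A"
    if g: "g \<in> carrier G" and A: "A \<subseteq> carrier G" for g A
    using outer_le[OF g A] outer_le[OF inv_closed[OF g] translate_subset[OF g A]]
    by (simp only: translate_inv(1)[OF g A] order.antisym)
  obtain \<mu> where \<mu>: "space \<mu> = topspace T" "sets \<mu> = sets (borel_of T)"
    "\<And>A. A \<in> sets \<mu> \<Longrightarrow> emeasure \<mu> A = outer_content A"
    "\<And>A. A \<in> sets \<mu> \<Longrightarrow> emeasure \<mu> A = (INF U\<in>{U. openin T U \<and> A \<subseteq> U}. emeasure \<mu> U)"
    "\<And>U. openin T U \<Longrightarrow> emeasure \<mu> U = (SUP C\<in>{C. compactin T C \<and> C \<subseteq> U}. emeasure \<mu> C)"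
    using regular_measure_exists by blast
  have sub: "subtopology T (carrier G) = T"
    by (simp flip: topspace_eq)
  have op: "emeasure \<mu> U = inner_content U" if "openin T U" for U
    using \<mu>(3)[of U] outer_open[OF that] openin_imp_sets_borel_of[OF that] \<mu>(2) by simp
  have "emeasure \<mu> (carrier G) = 1"
  proof -
    have "inner_content (carrier G) = ennreal (l (carrier G))"
      unfolding inner_content_def
    proof (rule antisym)
      show "(SUP C\<in>{C. closedin T C \<and> C \<subseteq> carrier G}. ennreal (l C)) \<le> ennreal (l (carrier G))"
        by (rule SUP_least) (auto intro!: ennreal_leI l(4))
      show "ennreal (l (carrier G)) \<le> (SUP C\<in>{C. closedin T C \<and> C \<subseteq> carrier G}. ennreal (l C))"
        using closedin_topspace[of T] by (intro SUP_upper) (simp add: topspace_eq)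
    qed
    then show ?thesis
      using op[OF openin_topspace] by (simp add: topspace_eq l(3))
  qed
  moreover have "emeasure \<mu> ((\<lambda>x. g \<otimes> x) ` A) = emeasure \<mu> A"
    if g: "g \<in> carrier G" and A: "A \<in> sets \<mu>" for g A
  proof -
    have A': "A \<subseteq> carrier G"
      using sets.sets_into_space[OF A] \<mu>(1) by (simp add: topspace_eq)
    have "(\<lambda>x. inv g \<otimes> x) \<in> measurable \<mu> \<mu>"
    proof -
      have "(\<lambda>x. inv g \<otimes> x) \<in> measurable \<mu> (sigma (topspace T) {U. openin T U})"
      proof (rule measurable_measure_of)
        show "{U. openin T U} \<subseteq> Pow (topspace T)"
          by (auto dest: openin_subset)
        show "(\<lambda>x. inv g \<otimes> x) \<in> space \<mu> \<rightarrow> topspace T"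
          using g by (simp add: \<mu>(1) topspace_eq)
        fix U assume "U \<in> {U. openin T U}"
        then have "openin T {x \<in> topspace T. inv g \<otimes> x \<in> U}"
          using translate_eq[OF g, of U] openin_translate[OF g, of U] openin_subset[of T U]
          by (simp add: topspace_eq)
        moreover have "(\<lambda>x. inv g \<otimes> x) -` U \<inter> space \<mu> = {x \<in> topspace T. inv g \<otimes> x \<in> U}"
          by (auto simp: \<mu>(1))
        ultimately show "(\<lambda>x. inv g \<otimes> x) -` U \<inter> space \<mu> \<in> sets \<mu>"
          using openin_imp_sets_borel_of \<mu>(2) by metis
      qed
      then show ?thesis
        unfolding borel_of_def[symmetric] using measurable_cong_sets[OF refl \<mu>(2)] by blast
    qed
    from measurable_sets[OF this A] have "(\<lambda>x. g \<otimes> x) ` A \<in> sets \<mu>"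
      unfolding translate_eq[OF g A'] \<mu>(1) by (simp add: vimage_def Int_def conj_commute)
    then show ?thesis
      using outer_eq[OF g A'] \<mu>(3) A by simp
  qed
  ultimately have "haar_measure G T (carrier G) \<mu>"
    unfolding haar_measure_def sub using \<mu>(2,4,5) \<mu>(1)[unfolded topspace_eq] by blast
  then show ?thesis ..
qed

lemma closed_subgroup_compact_group:
  assumes H: "subgroup H G" and closed: "closedin T H"
  shows "compact_group (G\<lparr>carrier := H\<rparr>) (subtopology T H)"
proof -
  interpret H: group "G\<lparr>carrier := H\<rparr>"
    by (rule subgroup.subgroup_is_group[OF H group_axioms])
  have sub: "H \<subseteq> carrier G"
    by (rule subgroup.subset[OF H])
  have top: "topspace (subtopology T H) = H"
    using sub by (auto simp: topspace_eq)
  have "continuous_map (prod_topology (subtopology T H) (subtopology T H)) (subtopology T H)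
      (\<lambda>p. fst p \<otimes> snd p)"
    unfolding continuous_map_in_subtopology
  proof
    show "continuous_map (prod_topology (subtopology T H) (subtopology T H)) T (\<lambda>p. fst p \<otimes> snd p)"
      by (intro continuous_mult continuous_map_into_fulltopology[OF continuous_map_fst]
          continuous_map_into_fulltopology[OF continuous_map_snd])
    show "(\<lambda>p. fst p \<otimes> snd p) \<in>
        topspace (prod_topology (subtopology T H) (subtopology T H)) \<rightarrow> H"
      using H by (auto simp: top subgroup.m_closed)
  qed
  moreover have "continuous_map (subtopology T H) (subtopology T H) (\<lambda>x. inv\<^bsub>G\<lparr>carrier := H\<rparr>\<^esub> x)"
  proof (rule continuous_map_eq)
    show "continuous_map (subtopology T H) (subtopology T H) (\<lambda>x. inv x)"
      unfolding continuous_map_in_subtopology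
    proof
      show "continuous_map (subtopology T H) T (\<lambda>x. inv x)"
        by (intro continuous_inv continuous_map_from_subtopology continuous_map_id[unfolded id_def])
      show "(\<lambda>x. inv x) \<in> topspace (subtopology T H) \<rightarrow> H"
        using H by (auto simp: top subgroup.m_inv_closed)
    qed
    show "inv x = inv\<^bsub>G\<lparr>carrier := H\<rparr>\<^esub> x" if "x \<in> topspace (subtopology T H)" for x
      using m_inv_consistent[OF H] that top by simp
  qed
  moreover have "compact_space (subtopology T H)"
    using closedin_compact_space[OF compact closed] compact_space_subtopology by blast
  ultimately show ?thesis
    unfolding compact_group_def using top H.group_axioms Hausdorff Hausdorff_space_subtopology by simp
qed

lemma haar_measure_subgroup_exists:
  assumes "subgroup H G" "closedin T H"
  shows "\<exists>\<mu>. haar_measure G T H \<mu>"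
proof -
  interpret H: compact_topological_group "G\<lparr>carrier := H\<rparr>" "subtopology T H"
    by unfold_locales (rule closed_subgroup_compact_group[OF assms])
  show ?thesis
    using H.haar_measure_exists by (simp add: haar_measure_def subtopology_subtopology)
qed

subsection \<open>Elements with finitely many conjugates\<close>

definition conj_class :: "'a \<Rightarrow> 'a set" where
  "conj_class h = (\<lambda>g. g \<otimes> h \<otimes> inv g) ` carrier G"

definition centralizer :: "'a \<Rightarrow> 'a set" where
  "centralizer h = {g \<in> carrier G. h \<otimes> g = g \<otimes> h}"

definition FC :: "'a set" where
  "FC = {h \<in> carrier G. finite (conj_class h)}"

definition FC_bounded :: "nat \<Rightarrow> 'a set" where
  "FC_bounded n = {h \<in> carrier G. finite (conj_class h) \<and> card (conj_class h) \<le> n}"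

lemma FC_eq_Union: "FC = (\<Union>n. FC_bounded n)"
  by (auto simp: FC_def FC_bounded_def)

lemma conj_class_subset: "h \<in> carrier G \<Longrightarrow> conj_class h \<subseteq> carrier G"
  by (auto simp: conj_class_def)

lemma self_in_conj_class: "h \<in> carrier G \<Longrightarrow> h \<in> conj_class h"
  unfolding conj_class_def by (rule image_eqI[of _ _ \<one>]) auto

lemma conj_fixes_iff:
  assumes "h \<in> carrier G" "g \<in> carrier G"
  shows "g \<otimes> h \<otimes> inv g = h \<longleftrightarrow> h \<otimes> g = g \<otimes> h"
  using assms inv_solve_right'[of h "g \<otimes> h" g] by auto

lemma conj_conj:
  assumes "h \<in> carrier G" "g \<in> carrier G" "k \<in> carrier G"
  shows "k \<otimes> (g \<otimes> h \<otimes> inv g) \<otimes> inv k = (k \<otimes> g) \<otimes> h \<otimes> inv (k \<otimes> g)"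
  using assms by (simp add: inv_mult_group m_assoc)

lemma conj_mult:
  assumes "h \<in> carrier G" "k \<in> carrier G" "g \<in> carrier G"
  shows "g \<otimes> (h \<otimes> k) \<otimes> inv g = (g \<otimes> h \<otimes> inv g) \<otimes> (g \<otimes> k \<otimes> inv g)"
proof -
  have "(g \<otimes> h \<otimes> inv g) \<otimes> (g \<otimes> k \<otimes> inv g) = g \<otimes> h \<otimes> (inv g \<otimes> g) \<otimes> k \<otimes> inv g"
    using assms by (simp only: m_assoc m_closed inv_closed)
  then show ?thesis
    using assms by (simp add: m_assoc)
qed

lemma subgroup_FC: "subgroup FC G"
proof
  show "FC \<subseteq> carrier G"
    by (auto simp: FC_def)
  have "conj_class \<one> \<subseteq> {\<one>}"
    by (auto simp: conj_class_def)
  then show "\<one> \<in> FC"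
    using finite_subset by (auto simp: FC_def)
  show "h \<otimes> k \<in> FC" if "h \<in> FC" "k \<in> FC" for h k
  proof -
    have hk: "h \<in> carrier G" "k \<in> carrier G"
      using that by (auto simp: FC_def)
    have "conj_class (h \<otimes> k) \<subseteq> (\<lambda>(a, b). a \<otimes> b) ` (conj_class h \<times> conj_class k)"
    proof
      fix y assume "y \<in> conj_class (h \<otimes> k)"
      then obtain g where g: "g \<in> carrier G" "y = g \<otimes> (h \<otimes> k) \<otimes> inv g"
        by (auto simp: conj_class_def)
      then have "y = (g \<otimes> h \<otimes> inv g) \<otimes> (g \<otimes> k \<otimes> inv g)"
        using hk conj_mult by simp
      then show "y \<in> (\<lambda>(a, b). a \<otimes> b) ` (conj_class h \<times> conj_class k)"
        using g(1) by (intro image_eqI[of _ _ "(g \<otimes> h \<otimes> inv g, g \<otimes> k \<otimes> inv g)"])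
          (auto simp: conj_class_def)
    qed
    then show ?thesis
      using that hk finite_subset by (fastforce simp: FC_def)
  qed
  show "inv h \<in> FC" if "h \<in> FC" for h
  proof -
    have h: "h \<in> carrier G"
      using that by (auto simp: FC_def)
    then have "conj_class (inv h) \<subseteq> (\<lambda>a. inv a) ` conj_class h"
      unfolding conj_class_def image_image
      by (intro image_mono equalityD1[OF image_cong]) (auto simp: inv_mult_group m_assoc)
    then show ?thesis
      using that h finite_subset by (fastforce simp: FC_def)
  qed
qed

lemma continuous_conj:
  assumes "continuous_map X T f" "continuous_map X T g"
  shows "continuous_map X T (\<lambda>x. g x \<otimes> f x \<otimes> inv (g x))"
  using assms by (intro continuous_mult continuous_inv)

lemma continuous_ident: "continuous_map T T (\<lambda>x. x)"
  using continuous_map_id by (simp add: id_def)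

lemma FC_bounded_iff:
  assumes h: "h \<in> carrier G"
  shows "h \<in> FC_bounded n \<longleftrightarrow>
    (\<forall>S. S \<subseteq> carrier G \<and> finite S \<and> card S = Suc n \<longrightarrow> \<not> inj_on (\<lambda>g. g \<otimes> h \<otimes> inv g) S)"
    (is "_ \<longleftrightarrow> ?R")
proof
  assume L: "h \<in> FC_bounded n"
  show ?R
  proof (intro allI impI notI)
    fix S assume S: "S \<subseteq> carrier G \<and> finite S \<and> card S = Suc n"
      and inj: "inj_on (\<lambda>g. g \<otimes> h \<otimes> inv g) S"
    have "Suc n = card ((\<lambda>g. g \<otimes> h \<otimes> inv g) ` S)"
      using S card_image[OF inj] by simp
    also have "\<dots> \<le> card (conj_class h)"
      using L S by (intro card_mono) (auto simp: FC_bounded_def conj_class_def)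
    finally show False
      using L by (simp add: FC_bounded_def)
  qed
next
  assume R: ?R
  show "h \<in> FC_bounded n"
  proof (rule ccontr)
    assume "h \<notin> FC_bounded n"
    then have "infinite (conj_class h) \<or> Suc n \<le> card (conj_class h)"
      using h by (auto simp: FC_bounded_def)
    then obtain B where B: "finite B" "card B = Suc n" "B \<subseteq> conj_class h"
      using infinite_arbitrarily_large obtain_subset_with_card_n by metis
    then obtain S where S: "S \<subseteq> carrier G" "inj_on (\<lambda>g. g \<otimes> h \<otimes> inv g) S"
        "B = (\<lambda>g. g \<otimes> h \<otimes> inv g) ` S"
      unfolding conj_class_def subset_image_inj by auto
    then have "card S = Suc n" "finite S"
      using B card_image[OF S(2)] finite_image_iff[OF S(2)] by auto
    then show False
      using R S by blast
  qed
qed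

lemma closedin_conj_not_inj:
  assumes "finite I" "\<And>i. i \<in> I \<Longrightarrow> r i \<in> carrier G"
  shows "closedin T {h \<in> topspace T. \<not> inj_on (\<lambda>i. r i \<otimes> h \<otimes> inv (r i)) I}"
proof -
  define P where "P = {(i, j). i \<in> I \<and> j \<in> I \<and> i \<noteq> j}"
  define C where "C = (\<lambda>(i, j). {h \<in> topspace T. r i \<otimes> h \<otimes> inv (r i) = r j \<otimes> h \<otimes> inv (r j)})"
  have "finite P"
    using assms(1) by (intro finite_subset[of P "I \<times> I"]) (auto simp: P_def)
  moreover have "closedin T (C p)" if pP: "p \<in> P" for p
  proof -
    obtain i j where p: "p = (i, j)" "i \<in> I" "j \<in> I"
      using pP unfolding P_def by blast
    show ?thesis
      unfolding p(1) C_def prod.case using assms(2) p(2,3)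
      by (intro closedin_continuous_maps_eq[OF Hausdorff] continuous_conj continuous_ident continuous_const)
  qed
  ultimately have "closedin T (\<Union>(C ` P))"
    by (intro closedin_Union) auto
  moreover have "{h \<in> topspace T. \<not> inj_on (\<lambda>i. r i \<otimes> h \<otimes> inv (r i)) I} = \<Union>(C ` P)"
    unfolding C_def P_def inj_on_def by blast
  ultimately show ?thesis by simp
qed

lemma closedin_FC_bounded: "closedin T (FC_bounded n)"
proof -
  let ?\<S> = "{S. S \<subseteq> carrier G \<and> finite S \<and> card S = Suc n}"
  let ?C = "\<lambda>S. {h \<in> topspace T. \<not> inj_on (\<lambda>g. g \<otimes> h \<otimes> inv g) S}"
  have "FC_bounded n = \<Inter>(insert (topspace T) (?C ` ?\<S>))"
  proof (rule Set.set_eqI)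
    fix h
    show "h \<in> FC_bounded n \<longleftrightarrow> h \<in> \<Inter>(insert (topspace T) (?C ` ?\<S>))"
    proof (cases "h \<in> carrier G")
      case True
      then show ?thesis
        unfolding FC_bounded_iff[OF True] by (simp add: topspace_eq)
    qed (simp add: FC_bounded_def topspace_eq)
  qed
  moreover have "closedin T (?C S)" if "S \<in> ?\<S>" for S
    using that by (intro closedin_conj_not_inj) auto
  ultimately show ?thesis
    by (simp only:) (rule closedin_Inter, auto)
qed

lemma closedin_centralizer: "h \<in> carrier G \<Longrightarrow> closedin T (centralizer h)"
  unfolding centralizer_def topspace_eq[symmetric]
  by (intro closedin_continuous_maps_eq[OF Hausdorff] continuous_mult continuous_ident continuous_const)
    (auto simp: topspace_eq)

lemma openin_centralizer_FC:
  assumes "h \<in> FC"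
  shows "openin T (centralizer h)"
proof -
  have h: "h \<in> carrier G" "finite (conj_class h)"
    using assms by (auto simp: FC_def)
  have "closedin T (conj_class h - {h})"
    using h conj_class_subset closedin_Hausdorff_finite[OF Hausdorff]
    by (metis Diff_subset finite_Diff order_trans topspace_eq)
  then have "closedin T {g \<in> topspace T. g \<otimes> h \<otimes> inv g \<in> conj_class h - {h}}"
    using h(1) by (intro closedin_continuous_map_preimage[OF continuous_conj[of T "\<lambda>_. h" "\<lambda>x. x"]]
        continuous_ident continuous_const)
  then have "openin T (topspace T - {g \<in> topspace T. g \<otimes> h \<otimes> inv g \<in> conj_class h - {h}})"
    by blast
  moreover have "topspace T - {g \<in> topspace T. g \<otimes> h \<otimes> inv g \<in> conj_class h - {h}} = centralizer h"
    using conj_fixes_iff[OF h(1)] by (auto simp: centralizer_def topspace_eq conj_class_def)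
  ultimately show ?thesis by simp
qed

lemma subgroup_centralizer: "h \<in> carrier G \<Longrightarrow> subgroup (centralizer h) G"
proof
  assume h: "h \<in> carrier G"
  show "centralizer h \<subseteq> carrier G" "\<one> \<in> centralizer h"
    using h by (auto simp: centralizer_def)
  show "x \<otimes> y \<in> centralizer h" if "x \<in> centralizer h" "y \<in> centralizer h" for x y
  proof -
    have xy: "x \<in> carrier G" "y \<in> carrier G" "h \<otimes> x = x \<otimes> h" "h \<otimes> y = y \<otimes> h"
      using that by (auto simp: centralizer_def)
    have "h \<otimes> (x \<otimes> y) = x \<otimes> (h \<otimes> y)"
      using xy(3) h xy(1,2) by (simp add: m_assoc[symmetric])
    then show ?thesis
      using xy h by (simp add: centralizer_def m_assoc)
  qed
  show "inv x \<in> centralizer h" if "x \<in> centralizer h" for x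
  proof -
    have x: "x \<in> carrier G" "h \<otimes> x = x \<otimes> h"
      using that by (auto simp: centralizer_def)
    have "inv x \<otimes> (h \<otimes> x) \<otimes> inv x = inv x \<otimes> (x \<otimes> h) \<otimes> inv x"
      by (simp only: x(2))
    moreover have "inv x \<otimes> (h \<otimes> x) \<otimes> inv x = inv x \<otimes> h"
      using x(1) h by (simp add: m_assoc)
    moreover have "inv x \<otimes> (x \<otimes> h) \<otimes> inv x = h \<otimes> inv x"
      using x(1) h by (simp add: m_assoc[symmetric])
    ultimately show ?thesis
      using x(1) by (simp add: centralizer_def)
  qed
qed

lemma locally_centralized:
  assumes w: "w \<in> FC"
  obtains U where "openin T U" "w \<in> U"
    "\<And>v g. v \<in> U \<Longrightarrow> finite (conj_class v) \<Longrightarrow> card (conj_class v) \<le> card (conj_class w) \<Longrightarrow>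
      g \<in> centralizer w \<Longrightarrow> v \<otimes> g = g \<otimes> v"
proof -
  have w': "w \<in> carrier G" "finite (conj_class w)"
    using w by (auto simp: FC_def)
  have "\<exists>g\<in>carrier G. g \<otimes> w \<otimes> inv g = q \<and> (q = w \<longrightarrow> g = \<one>)" if "q \<in> conj_class w" for q
  proof (cases "q = w")
    case True
    then show ?thesis
      using w'(1) by (intro bexI[of _ \<one>]) auto
  next
    case False
    then show ?thesis
      using that by (auto simp: conj_class_def)
  qed
  then obtain r where r_all: "\<forall>q\<in>conj_class w. r q \<in> carrier G \<and> r q \<otimes> w \<otimes> inv (r q) = q \<and>
      (q = w \<longrightarrow> r q = \<one>)"
    by metis
  then have r: "\<And>q. q \<in> conj_class w \<Longrightarrow> r q \<in> carrier G"
      "\<And>q. q \<in> conj_class w \<Longrightarrow> r q \<otimes> w \<otimes> inv (r q) = q" "r w = \<one>"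
    using self_in_conj_class[OF w'(1)] by auto
  let ?c = "\<lambda>q v. r q \<otimes> v \<otimes> inv (r q)"
  define D where "D = {v \<in> topspace T. \<not> inj_on (\<lambda>q. ?c q v) (conj_class w)}"
  have D: "closedin T D"
    unfolding D_def by (rule closedin_conj_not_inj[OF w'(2) r(1)])
  define E where "E = (\<Union>q\<in>conj_class w - {w}.
      {p \<in> topspace (prod_topology T T). snd p \<otimes> fst p \<otimes> inv (snd p) = ?c q (fst p)})"
  have "closedin (prod_topology T T) E"
    unfolding E_def
  proof (rule closedin_Union)
    fix A assume "A \<in> (\<lambda>q. {p \<in> topspace (prod_topology T T).
        snd p \<otimes> fst p \<otimes> inv (snd p) = ?c q (fst p)}) ` (conj_class w - {w})"
    then obtain q where q: "q \<in> conj_class w" "A = {p \<in> topspace (prod_topology T T).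
        snd p \<otimes> fst p \<otimes> inv (snd p) = ?c q (fst p)}"
      by auto
    show "closedin (prod_topology T T) A"
      unfolding q(2) using r(1) q(1)
      by (intro closedin_continuous_maps_eq[OF Hausdorff] continuous_conj continuous_map_fst
          continuous_map_snd continuous_const)
  qed (use w'(2) in simp)
  then have W: "openin (prod_topology T T) (topspace (prod_topology T T) - E)"
    by blast
  have "{w} \<times> centralizer w \<subseteq> topspace (prod_topology T T) - E"
  proof clarify
    fix g assume g: "g \<in> centralizer w"
    then have "g \<in> carrier G" "g \<otimes> w \<otimes> inv g = w"
      using conj_fixes_iff[OF w'(1)] by (auto simp: centralizer_def)
    then show "(w, g) \<in> topspace (prod_topology T T) - E"
      using w'(1) r(2) by (auto simp: E_def topspace_eq)
  qed
  moreover have "compactin T (centralizer w)"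
    using closedin_compact_space[OF compact closedin_centralizer[OF w'(1)]] .
  ultimately obtain U V where U: "openin T U" "w \<in> U" "centralizer w \<subseteq> V"
      "U \<times> V \<subseteq> topspace (prod_topology T T) - E"
    using tube_lemma_right[OF W] w'(1) topspace_eq by metis
  show thesis
  proof
    show "openin T (U - D)"
      using U(1) D by blast
    have "inj_on (\<lambda>q. ?c q w) (conj_class w)"
      by (rule inj_onI) (simp add: r(2))
    then show "w \<in> U - D"
      using U(2) by (simp add: D_def)
    fix v g assume v: "v \<in> U - D" "finite (conj_class v)" "card (conj_class v) \<le> card (conj_class w)"
      and g: "g \<in> centralizer w"
    have vG: "v \<in> carrier G"
      using v(1) openin_subset[OF U(1)] by (auto simp: topspace_eq)
    have gG: "g \<in> carrier G"
      using g by (simp add: centralizer_def)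
    have inj: "inj_on (\<lambda>q. ?c q v) (conj_class w)"
      using v(1) vG by (simp add: D_def topspace_eq)
    have sub: "(\<lambda>q. ?c q v) ` conj_class w \<subseteq> conj_class v"
      using r(1) by (auto simp: conj_class_def)
    have "(\<lambda>q. ?c q v) ` conj_class w = conj_class v"
      using card_image[OF inj] v(3) card_mono[OF v(2) sub]
      by (intro card_subset_eq[OF v(2) sub]) simp
    moreover have "g \<otimes> v \<otimes> inv g \<in> conj_class v"
      using gG by (auto simp: conj_class_def)
    ultimately obtain q where q: "q \<in> conj_class w" "g \<otimes> v \<otimes> inv g = ?c q v"
      by (metis (no_types, lifting) imageE)
    have "(v, g) \<in> U \<times> V"
      using v(1) g U(3) by auto
    then have "(v, g) \<notin> E"
      using U(4) by blast
    then have "q = w"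
      using q vG gG by (auto simp: E_def topspace_eq)
    then have "g \<otimes> v \<otimes> inv g = v"
      using q(2) r(3) vG by simp
    then show "v \<otimes> g = g \<otimes> v"
      using conj_fixes_iff[OF vG gG] by simp
  qed
qed

subsection \<open>An open normal subgroup centralized by powers\<close>

lemma subgroup_closure_of:
  assumes H: "subgroup H G"
  shows "subgroup (T closure_of H) G"
proof
  show "T closure_of H \<subseteq> carrier G"
    using closure_of_subset_topspace[of T H] by (simp add: topspace_eq)
  have "H \<subseteq> T closure_of H"
    using subgroup.subset[OF H] by (intro closure_of_subset) (simp add: topspace_eq)
  then show "\<one> \<in> T closure_of H"
    using subgroup.one_closed[OF H] by blast
  show "x \<otimes> y \<in> T closure_of H" if xy: "x \<in> T closure_of H" "y \<in> T closure_of H" for x y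
  proof -
    have cont: "continuous_map (prod_topology T T) T (\<lambda>p. fst p \<otimes> snd p)"
      by (intro continuous_mult continuous_map_fst continuous_map_snd)
    have "(\<lambda>p. fst p \<otimes> snd p) ` (H \<times> H) \<subseteq> H"
      using subgroup.m_closed[OF H] by auto
    then have "(\<lambda>p. fst p \<otimes> snd p) ` ((T closure_of H) \<times> (T closure_of H)) \<subseteq> T closure_of H"
      using continuous_map_image_closure_subset[OF cont, of "H \<times> H"] closure_of_mono
      by (fastforce simp: closure_of_Times)
    then have "(\<lambda>p. fst p \<otimes> snd p) (x, y) \<in> T closure_of H"
      using xy by blast
    then show ?thesis by simp
  qed
  show "inv x \<in> T closure_of H" if x: "x \<in> T closure_of H" for x
  proof -
    have "(\<lambda>x. inv x) ` H \<subseteq> H"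
      using subgroup.m_inv_closed[OF H] by auto
    then have "(\<lambda>x. inv x) ` (T closure_of H) \<subseteq> T closure_of H"
      using continuous_map_image_closure_subset[OF continuous_inv[OF continuous_ident], of H] closure_of_mono
      by fastforce
    then show ?thesis
      using x by blast
  qed
qed

lemma pow_recurrent:
  assumes U: "one_nbhd U" and x: "x \<in> carrier G"
  obtains j :: nat where "0 < j" "x [^] j \<in> U"
proof -
  have A: "closedin T {\<one>}"
    using closedin_Hausdorff_sing_eq[OF Hausdorff] by (simp add: topspace_eq)
  have B: "closedin T (carrier G - U)"
    using U by (auto simp: one_nbhd_def topspace_eq[symmetric])
  have AB: "{\<one>} \<inter> (carrier G - U) = {}"
    using U by (simp add: one_nbhd_def)
  obtain V where V: "one_nbhd V" and sep: "\<And>a b u v. a \<in> {\<one>} \<Longrightarrow> b \<in> carrier G - U \<Longrightarrow>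
      u \<in> V \<Longrightarrow> v \<in> V \<Longrightarrow> inv a \<otimes> b \<noteq> inv u \<otimes> v"
    using disjoint_closed_separated[OF A B AB] by blast
  have V': "V \<subseteq> carrier G"
    using V openin_subset[of T V] by (simp add: one_nbhd_def topspace_eq)
  have diff: "inv u \<otimes> v \<in> U" if uv: "u \<in> V" "v \<in> V" for u v
  proof (rule ccontr)
    assume "inv u \<otimes> v \<notin> U"
    then have "inv \<one> \<otimes> (inv u \<otimes> v) \<noteq> inv u \<otimes> v"
      using uv V' by (intro sep) auto
    then show False
      using uv V' by (simp add: subset_iff)
  qed
  obtain S where S: "finite S" "S \<subseteq> carrier G" "carrier G \<subseteq> (\<Union>s\<in>S. (\<lambda>x. s \<otimes> x) ` V)"
    using translate_cover_exists[OF V subset_refl] by (auto simp: translate_cover_def)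
  have "\<exists>s\<in>S. x [^] i \<in> (\<lambda>x. s \<otimes> x) ` V" for i :: nat
    using S(3) nat_pow_closed[OF x, of i] by blast
  then obtain f where f: "\<And>i::nat. f i \<in> S" "\<And>i. x [^] i \<in> (\<lambda>x. f i \<otimes> x) ` V"
    by metis
  have "\<not> inj f"
    using f(1) S(1) finite_subset[of "range f" S] finite_imageD[of f UNIV] by auto
  then obtain i j where ij: "i < j" "f i = f j"
    unfolding inj_on_def by (metis nat_neq_iff)
  obtain u v where uv: "u \<in> V" "v \<in> V" "x [^] i = f i \<otimes> u" "x [^] j = f i \<otimes> v"
    using f(2)[of i] f(2)[of j] ij(2) by auto
  have carr: "u \<in> carrier G" "v \<in> carrier G" "f i \<in> carrier G"
    using uv(1,2) V' f(1)[of i] S(2) by auto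
  have "x [^] i \<otimes> x [^] (j - i) = x [^] j"
    using ij(1) x by (simp add: nat_pow_mult)
  then have "x [^] (j - i) = inv (x [^] i) \<otimes> x [^] j"
    using x by (metis inv_solve_left nat_pow_closed)
  also have "\<dots> = inv u \<otimes> v"
    unfolding uv(3,4) using carr by (simp add: inv_mult_group m_assoc) (simp add: m_assoc[symmetric])
  finally have "x [^] (j - i) \<in> U"
    using diff uv(1,2) by simp
  then show thesis
    using that[of "j - i"] ij(1) by simp
qed

lemma conj_class_conj_subset:
  assumes w: "w \<in> carrier G" and q: "q \<in> conj_class w"
  shows "conj_class q \<subseteq> conj_class w"
proof -
  obtain g where g: "g \<in> carrier G" "q = g \<otimes> w \<otimes> inv g"
    using q by (auto simp: conj_class_def)
  show ?thesis
    unfolding conj_class_def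
  proof clarify
    fix k assume k: "k \<in> carrier G"
    then have "k \<otimes> q \<otimes> inv k = (k \<otimes> g) \<otimes> w \<otimes> inv (k \<otimes> g)"
      unfolding g(2) by (intro conj_conj w g(1))
    then show "k \<otimes> q \<otimes> inv k \<in> (\<lambda>g. g \<otimes> w \<otimes> inv g) ` carrier G"
      using k g(1) by blast
  qed
qed

definition conj_centralizer :: "'a \<Rightarrow> 'a set" where
  "conj_centralizer w = \<Inter>(centralizer ` conj_class w)"

lemma conj_centralizer_subset: "w \<in> carrier G \<Longrightarrow> conj_centralizer w \<subseteq> centralizer w"
  using self_in_conj_class by (auto simp: conj_centralizer_def)

lemma openin_conj_centralizer:
  assumes "w \<in> FC"
  shows "openin T (conj_centralizer w)"
proof -
  have w: "w \<in> carrier G" "finite (conj_class w)"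
    using assms by (auto simp: FC_def)
  have "q \<in> FC" if "q \<in> conj_class w" for q
    using conj_class_conj_subset[OF w(1) that] conj_class_subset[OF w(1)] w(2) that finite_subset
    unfolding FC_def by blast
  then show ?thesis
    unfolding conj_centralizer_def using w self_in_conj_class[OF w(1)]
    by (intro openin_Inter) (auto intro: openin_centralizer_FC)
qed

lemma normal_conj_centralizer:
  assumes w: "w \<in> carrier G"
  shows "conj_centralizer w \<lhd> G"
  unfolding normal_inv_iff
proof (intro conjI ballI)
  have sub: "q \<in> carrier G" if "q \<in> conj_class w" for q
    using conj_class_subset[OF w] that by blast
  show "subgroup (conj_centralizer w) G"
    unfolding conj_centralizer_def
    using self_in_conj_class[OF w] subgroup_centralizer sub by (intro subgroups_Inter) auto
  fix x n assume x: "x \<in> carrier G" and n: "n \<in> conj_centralizer w"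
  then have nG: "n \<in> carrier G"
    using conj_centralizer_subset[OF w] by (auto simp: centralizer_def)
  show "x \<otimes> n \<otimes> inv x \<in> conj_centralizer w"
    unfolding conj_centralizer_def
  proof clarify
    fix q assume q: "q \<in> conj_class w"
    let ?p = "inv x \<otimes> q \<otimes> x"
    have "inv x \<otimes> q \<otimes> inv (inv x) \<in> conj_class q"
      using x unfolding conj_class_def by (intro imageI) simp
    then have "?p \<in> conj_class w"
      using conj_class_conj_subset[OF w q] x by auto
    then have p: "?p \<otimes> n = n \<otimes> ?p"
      using n by (auto simp: conj_centralizer_def centralizer_def)
    have "q \<otimes> (x \<otimes> n \<otimes> inv x) = x \<otimes> (?p \<otimes> n) \<otimes> inv x"
      using x nG sub[OF q] by (simp add: m_assoc[symmetric])
    also have "\<dots> = (x \<otimes> n \<otimes> inv x) \<otimes> q"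
      unfolding p using x nG sub[OF q] by (simp add: m_assoc)
    finally show "x \<otimes> n \<otimes> inv x \<in> centralizer q"
      using x nG by (simp add: centralizer_def)
  qed
qed

lemma Baire_pow_FC_bounded:
  assumes L: "closedin T L" "L \<noteq> {}"
    and FC: "\<And>x. x \<in> L \<Longrightarrow> \<exists>m>0. x [^] (m::nat) \<in> FC"
  obtains m n W where "0 < m" "openin (subtopology T L) W" "W \<noteq> {}"
    "\<And>z. z \<in> W \<Longrightarrow> z [^] (m::nat) \<in> FC_bounded n"
proof -
  let ?X = "subtopology T L"
  have top: "topspace ?X = L"
    using closedin_subset[OF L(1)] by auto
  have comp: "compact_space ?X"
    using closedin_compact_space[OF compact L(1)] compact_space_subtopology by blast
  have "regular_space ?X"
    using comp Hausdorff Hausdorff_space_subtopology compact_Hausdorff_imp_regular_space by blast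
  then have X: "completely_metrizable_space ?X \<or> locally_compact_space ?X \<and> regular_space ?X"
    using comp compact_imp_locally_compact_space by blast
  define A where "A = (\<lambda>(m, n). {x \<in> topspace ?X. x [^] (m::nat) \<in> FC_bounded n})"
  define I where "I = {0::nat<..} \<times> (UNIV :: nat set)"
  have cont: "continuous_map ?X T (\<lambda>x. x [^] (m::nat))" for m
    by (intro continuous_pow continuous_map_from_subtopology continuous_ident)
  have closed: "closedin ?X (A p)" for p
    unfolding A_def
    using closedin_continuous_map_preimage[OF cont closedin_FC_bounded] by (cases p) simp
  have "L \<subseteq> \<Union>(A ` I)"
  proof
    fix x assume x: "x \<in> L"
    then obtain m n where "0 < m" "x [^] (m::nat) \<in> FC_bounded n"
      using FC unfolding FC_eq_Union by blast
    then have "x \<in> A (m, n)" "(m, n) \<in> I"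
      using x top by (auto simp: A_def I_def)
    then show "x \<in> \<Union>(A ` I)" by blast
  qed
  moreover have "\<Union>(A ` I) \<subseteq> topspace ?X"
    by (auto simp: A_def)
  ultimately have "\<Union>(A ` I) = topspace ?X"
    using top by blast
  then have "?X interior_of \<Union>(A ` I) = topspace ?X"
    by (simp only: interior_of_topspace)
  then have "?X interior_of \<Union>(A ` I) \<noteq> {}"
    using L(2) top by metis
  moreover have "?X interior_of \<Union>(A ` I) = {}" if "\<forall>p\<in>I. ?X interior_of (A p) = {}"
  proof (rule Baire_category_alt[OF X])
    show "countable (A ` I)"
      by (intro countable_image) (auto simp: I_def)
    show "closedin ?X B \<and> ?X interior_of B = {}" if "B \<in> A ` I" for B
      using that closed \<open>\<forall>p\<in>I. ?X interior_of (A p) = {}\<close> by blast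
  qed
  ultimately obtain p where p: "p \<in> I" "?X interior_of (A p) \<noteq> {}"
    by blast
  obtain m n where mn: "p = (m, n)" "0 < m"
    using p(1) by (auto simp: I_def)
  have "z [^] m \<in> FC_bounded n" if "z \<in> ?X interior_of (A p)" for z
    using that interior_of_subset[of ?X "A p"] by (auto simp: A_def mn(1))
  then show thesis
    using that[of m "?X interior_of (A p)" n] mn(2) p(2) by simp
qed

lemma open_normal_of_FC_powers:
  assumes K: "subgroup K G" "closedin T K"
    and pow: "\<And>x. x \<in> K \<Longrightarrow> \<exists>m>0. x [^] (m::nat) \<in> FC"
  obtains N where "openin T N" "N \<lhd> G"
    "\<And>x. x \<in> K \<Longrightarrow> \<exists>n>0. \<forall>t\<in>N. x [^] (n::nat) \<otimes> t = t \<otimes> x [^] n"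
proof -
  have KG: "K \<subseteq> carrier G"
    by (rule subgroup.subset[OF K(1)])
  define F where "F = FC \<inter> K"
  define L where "L = T closure_of F"
  have F: "subgroup F G"
    unfolding F_def by (rule subgroups_Inter_pair[OF subgroup_FC K(1)])
  have L: "subgroup L G"
    unfolding L_def by (rule subgroup_closure_of[OF F])
  have LG: "L \<subseteq> carrier G"
    by (rule subgroup.subset[OF L])
  have L_closed: "closedin T L"
    by (simp add: L_def)
  have FL: "F \<subseteq> L"
    unfolding L_def using subgroup.subset[OF F] by (intro closure_of_subset) (simp add: topspace_eq)
  have LK: "L \<subseteq> K"
    unfolding L_def F_def by (rule closure_of_minimal[OF _ K(2)]) blast
  obtain m W n where m: "0 < m" and W: "openin (subtopology T L) W" "W \<noteq> {}"
    and bounded: "\<And>z. z \<in> W \<Longrightarrow> z [^] (m::nat) \<in> FC_bounded n"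
  proof (rule Baire_pow_FC_bounded[OF L_closed])
    show "L \<noteq> {}"
      using subgroup.one_closed[OF L] by blast
    show "\<exists>m>0. x [^] (m::nat) \<in> FC" if "x \<in> L" for x
      using that pow LK by blast
  qed (rule that)
  have WL: "W \<subseteq> L"
    using openin_subset[OF W(1)] by simp
  let ?k = "\<lambda>z. card (conj_class (z [^] m))"
  obtain y where y: "y \<in> W" "\<And>z. z \<in> W \<Longrightarrow> ?k z \<le> ?k y"
  proof -
    obtain z where "z \<in> W"
      using W(2) by blast
    moreover have "\<forall>z. z \<in> W \<longrightarrow> ?k z < Suc n"
      using bounded by (auto simp: FC_bounded_def less_Suc_eq_le)
    ultimately show thesis
      using that Lattices_Big.ex_has_greatest_nat[of "\<lambda>z. z \<in> W" z ?k "Suc n"]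
      by blast
  qed
  define w where "w = y [^] m"
  have w: "w \<in> FC" "w \<in> carrier G"
    using bounded[OF y(1)] by (auto simp: w_def FC_bounded_def FC_def)
  obtain U where U: "openin T U" "w \<in> U"
    "\<And>v g. v \<in> U \<Longrightarrow> finite (conj_class v) \<Longrightarrow> card (conj_class v) \<le> card (conj_class w) \<Longrightarrow>
      g \<in> centralizer w \<Longrightarrow> v \<otimes> g = g \<otimes> v"
    using locally_centralized[OF w(1)] by blast
  define N where "N = conj_centralizer w"
  have N: "openin T N" "N \<lhd> G"
    unfolding N_def by (rule openin_conj_centralizer[OF w(1)], rule normal_conj_centralizer[OF w(2)])
  have NG: "N \<subseteq> carrier G"
    using openin_subset[OF N(1)] by (simp add: topspace_eq)
  define V where "V = W \<inter> {z \<in> topspace (subtopology T L). z [^] m \<in> U}"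
  have "continuous_map (subtopology T L) T (\<lambda>z. z [^] m)"
    by (intro continuous_pow continuous_map_from_subtopology continuous_ident)
  then have V: "openin (subtopology T L) V"
    unfolding V_def using openin_continuous_map_preimage[OF _ U(1)] W(1) by (intro openin_Int)
  have yV: "y \<in> V"
    using y(1) U(2) WL LG by (auto simp: V_def w_def topspace_eq)
  have V_comm: "z [^] m \<otimes> t = t \<otimes> z [^] m" if z: "z \<in> V" and t: "t \<in> N" for z t
  proof (rule U(3))
    show "z [^] m \<in> U"
      using z by (simp add: V_def)
    show "finite (conj_class (z [^] m))"
      using z bounded by (auto simp: V_def FC_bounded_def)
    show "card (conj_class (z [^] m)) \<le> card (conj_class w)"
      using z y(2) by (simp add: V_def w_def)
    show "t \<in> centralizer w"
      using t conj_centralizer_subset[OF w(2)] by (auto simp: N_def)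
  qed
  obtain V' where V': "openin T V'" "V = V' \<inter> L"
    using V by (auto simp: openin_subtopology)
  have "V' \<inter> T closure_of F \<noteq> {}"
    using yV V'(2) by (auto simp: L_def)
  then obtain f where f: "f \<in> V'" "f \<in> F"
    using openin_Int_closure_of_eq_empty[OF V'(1)] by blast
  have fG: "f \<in> carrier G"
    using f(2) subgroup.subset[OF F] by blast
  define S where "S = {s \<in> topspace T. f \<otimes> s \<in> V'} \<inter> centralizer f"
  have "openin T {s \<in> topspace T. f \<otimes> s \<in> V'}"
    using fG by (intro openin_continuous_map_preimage[OF _ V'(1)] continuous_mult continuous_ident continuous_const)
  then have S: "one_nbhd S"
    unfolding one_nbhd_def S_def using f fG openin_centralizer_FC[of f]
    by (auto simp: F_def topspace_eq centralizer_def)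
  have S_comm: "s [^] m \<otimes> t = t \<otimes> s [^] m" if s: "s \<in> S" "s \<in> L" and t: "t \<in> N" for s t
  proof -
    have sG: "s \<in> carrier G" and tG: "t \<in> carrier G"
      using s(2) LG t NG by auto
    have "f \<otimes> s \<in> V" "f \<in> V"
      using s f FL subgroup.m_closed[OF L] V'(2) by (auto simp: S_def)
    then have "(f \<otimes> s) [^] m \<in> centralizer t" "f [^] m \<in> centralizer t"
      using V_comm t fG sG by (auto simp: centralizer_def)
    moreover have "(f \<otimes> s) [^] m = f [^] m \<otimes> s [^] m"
      using s(1) fG sG by (intro pow_mult_distrib) (auto simp: S_def centralizer_def)
    ultimately have "inv (f [^] m) \<otimes> (f [^] m \<otimes> s [^] m) \<in> centralizer t"
      using subgroup.m_closed subgroup.m_inv_closed subgroup_centralizer[OF tG] by metis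
    moreover have "inv (f [^] m) \<otimes> (f [^] m \<otimes> s [^] m) = s [^] m"
      using fG sG by (simp add: m_assoc[symmetric])
    ultimately show ?thesis
      by (simp add: centralizer_def)
  qed
  have "\<exists>n>0. \<forall>t\<in>N. x [^] (n::nat) \<otimes> t = t \<otimes> x [^] n" if x: "x \<in> K" for x
  proof -
    have xG: "x \<in> carrier G"
      using x KG by blast
    obtain i where i: "0 < i" "x [^] (i::nat) \<in> FC"
      using pow[OF x] by blast
    then have xi: "x [^] i \<in> L"
      using FL subgroup_pow_closed[OF K(1) x] by (auto simp: F_def)
    obtain j where j: "0 < j" "(x [^] i) [^] (j::nat) \<in> S"
      using pow_recurrent[OF S nat_pow_closed[OF xG]] by blast
    have "((x [^] i) [^] j) [^] m = x [^] (i * j * m)"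
      using xG by (simp add: nat_pow_pow)
    then have "\<forall>t\<in>N. x [^] (i * j * m) \<otimes> t = t \<otimes> x [^] (i * j * m)"
      using S_comm[OF j(2) subgroup_pow_closed[OF L xi]] by simp
    then show ?thesis
      using i(1) j(1) m by (intro exI[of _ "i * j * m"]) simp
  qed
  then show thesis
    using that[OF N] by blast
qed

subsection \<open>Haar measure and the commuting probability\<close>

lemma haar_measureD:
  assumes "haar_measure G T H \<mu>"
  shows "emeasure \<mu> H = 1" "space \<mu> = H" "sets \<mu> = sets (borel_of (subtopology T H))"
    "\<And>g A. g \<in> H \<Longrightarrow> A \<in> sets \<mu> \<Longrightarrow> emeasure \<mu> ((\<lambda>x. g \<otimes> x) ` A) = emeasure \<mu> A"
  using assms by (auto simp: haar_measure_def)

lemma haar_measure_closed_sets: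
  assumes "haar_measure G T H \<mu>" "closedin T C" "C \<subseteq> H"
  shows "C \<in> sets \<mu>"
  unfolding haar_measureD(3)[OF assms(1)] using assms(2,3)
  by (intro closedin_imp_sets_borel_of) (auto simp: closedin_subtopology)

lemma haar_measure_null_of_disjoint_translates:
  fixes g :: "nat \<Rightarrow> 'a"
  assumes haar: "haar_measure G T H \<mu>" and E: "E \<in> sets \<mu>" and g: "\<And>i. g i \<in> H"
    and disj: "disjoint_family (\<lambda>i. (\<lambda>x. g i \<otimes> x) ` E)"
  shows "emeasure \<mu> E = 0"
proof (rule ccontr)
  assume pos: "emeasure \<mu> E \<noteq> 0"
  have eq: "emeasure \<mu> ((\<lambda>x. g i \<otimes> x) ` E) = emeasure \<mu> E" for i
    using haar_measureD(4)[OF haar g E] .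
  \<comment> \<open>Non-measurable sets have \<open>emeasure\<close> zero, so translation invariance makes the translates measurable.\<close>
  have sets: "(\<lambda>x. g i \<otimes> x) ` E \<in> sets \<mu>" for i
    using eq[of i] pos by (intro emeasure_neq_0_sets) simp
  have le1: "emeasure \<mu> A \<le> 1" for A
    using emeasure_space[of \<mu> A] haar_measureD(1,2)[OF haar] by simp
  have bound: "of_nat n * emeasure \<mu> E \<le> 1" for n
  proof -
    have "of_nat n * emeasure \<mu> E = (\<Sum>i<n. emeasure \<mu> ((\<lambda>x. g i \<otimes> x) ` E))"
      by (simp add: eq)
    also have "\<dots> \<le> (\<Sum>i. emeasure \<mu> ((\<lambda>x. g i \<otimes> x) ` E))"
      by (rule sum_le_suminf) auto
    also have "\<dots> = emeasure \<mu> (\<Union>i. (\<lambda>x. g i \<otimes> x) ` E)"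
      using sets disj by (intro suminf_emeasure) auto
    also have "\<dots> \<le> 1"
      by (rule le1)
    finally show ?thesis .
  qed
  obtain r where r: "emeasure \<mu> E = ennreal r" "0 \<le> r"
    using le1[of E] by (cases "emeasure \<mu> E") (auto simp: top_unique)
  then have "0 < r"
    using pos by (cases "r = 0") auto
  then obtain n where "1 < of_nat n * r"
    using reals_Archimedean3 by blast
  then show False
    using bound[of n] r by (simp add: ennreal_of_nat_eq_real_of_nat flip: ennreal_mult)
qed

lemma haar_measure_pos_of_finite_cover:
  assumes haar: "haar_measure G T H \<mu>" and M: "M \<in> sets \<mu>"
    and S: "finite S" "S \<subseteq> H" "\<And>s. s \<in> S \<Longrightarrow> (\<lambda>x. s \<otimes> x) ` M \<in> sets \<mu>"
    and cover: "H \<subseteq> (\<Union>s\<in>S. (\<lambda>x. s \<otimes> x) ` M)"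
  shows "0 < emeasure \<mu> M"
proof (rule ccontr)
  assume "\<not> 0 < emeasure \<mu> M"
  then have zero: "emeasure \<mu> ((\<lambda>x. s \<otimes> x) ` M) = 0" if "s \<in> S" for s
    using haar_measureD(4)[OF haar _ M] S(2) that by auto
  have "emeasure \<mu> H \<le> emeasure \<mu> (\<Union>s\<in>S. (\<lambda>x. s \<otimes> x) ` M)"
    using cover S by (intro emeasure_mono sets.finite_UN) auto
  also have "\<dots> \<le> (\<Sum>s\<in>S. emeasure \<mu> ((\<lambda>x. s \<otimes> x) ` M))"
    using S by (intro emeasure_subadditive_finite) auto
  also have "\<dots> = 0"
    using zero by simp
  finally show False
    using haar_measureD(1)[OF haar] by simp
qed

lemma monothetic_subgroup:
  assumes "x \<in> carrier G"
  shows "subgroup (monothetic G T x) G" "closedin T (monothetic G T x)" "x \<in> monothetic G T x"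
proof -
  have gen: "subgroup (generate G {x}) G"
    using assms by (intro generate_is_subgroup) auto
  then show "subgroup (monothetic G T x) G"
    unfolding monothetic_def by (rule subgroup_closure_of)
  show "closedin T (monothetic G T x)"
    by (simp add: monothetic_def)
  have "generate G {x} \<subseteq> monothetic G T x"
    unfolding monothetic_def
    using subgroup.subset[OF gen] by (intro closure_of_subset) (simp add: topspace_eq)
  then show "x \<in> monothetic G T x"
    using generate.incl[of x "{x}" G] by blast
qed

lemma haar_measure_centralizer_null:
  assumes haar: "haar_measure G T (carrier G) \<mu>" and h: "h \<in> carrier G" "h \<notin> FC"
  shows "emeasure \<mu> (centralizer h) = 0"
proof -
  have "infinite (conj_class h)"
    using h by (simp add: FC_def)
  then obtain f :: "nat \<Rightarrow> 'a" where f: "inj f" "range f \<subseteq> conj_class h"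
    using infinite_countable_subset by blast
  then have "\<forall>i. \<exists>g\<in>carrier G. f i = g \<otimes> h \<otimes> inv g"
    by (auto simp: conj_class_def)
  then obtain g where g: "\<And>i. g i \<in> carrier G" "\<And>i. f i = g i \<otimes> h \<otimes> inv (g i)"
    by metis
  have coset: "(g i \<otimes> c) \<otimes> h \<otimes> inv (g i \<otimes> c) = f i" if c: "c \<in> centralizer h" for i c
  proof -
    have "c \<in> carrier G" "c \<otimes> h \<otimes> inv c = h"
      using c conj_fixes_iff[OF h(1)] by (auto simp: centralizer_def)
    then show ?thesis
      using conj_conj[OF h(1) _ g(1)] g(2) by metis
  qed
  have "disjoint_family (\<lambda>i. (\<lambda>x. g i \<otimes> x) ` centralizer h)"
    unfolding disjoint_family_on_def
  proof (intro ballI impI)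
    fix i j :: nat assume "i \<noteq> j"
    then have "f i \<noteq> f j"
      using f(1) by (auto dest: injD)
    then show "(\<lambda>x. g i \<otimes> x) ` centralizer h \<inter> (\<lambda>x. g j \<otimes> x) ` centralizer h = {}"
      using coset[of _ i] coset[of _ j] by fastforce
  qed
  moreover have "centralizer h \<in> sets \<mu>"
    using closedin_centralizer[OF h(1)] by (intro haar_measure_closed_sets[OF haar]) (auto simp: centralizer_def)
  ultimately show ?thesis
    using haar_measure_null_of_disjoint_translates[OF haar] g(1) by blast
qed

lemma pow_FC_of_commuting_prob_pos:
  assumes x: "x \<in> carrier G"
    and H: "haar_measure G T (monothetic G T x) \<mu>H" and G: "haar_measure G T (carrier G) \<mu>G"
    and pos: "0 < commuting_prob G (monothetic G T x) \<mu>H \<mu>G"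
  shows "\<exists>m>0. x [^] (m::nat) \<in> FC"
proof (rule ccontr)
  assume none: "\<not> (\<exists>m>0. x [^] (m::nat) \<in> FC)"
  let ?H = "monothetic G T x"
  note mono = monothetic_subgroup[OF x]
  have HG: "?H \<subseteq> carrier G"
    by (rule subgroup.subset[OF mono(1)])
  define E where "E = ?H \<inter> FC"
  have E_sub: "subgroup E G"
    unfolding E_def by (rule subgroups_Inter_pair[OF mono(1) subgroup_FC])
  have EG: "E \<subseteq> carrier G"
    by (rule subgroup.subset[OF E_sub])
  have "?H \<inter> FC_bounded n \<in> sets \<mu>H" for n
    using mono(2) closedin_FC_bounded by (intro haar_measure_closed_sets[OF H] closedin_Int) auto
  then have E_sets: "E \<in> sets \<mu>H"
    unfolding E_def FC_eq_Union Int_UN_distrib by (intro sets.countable_UN) auto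
  have "disjoint_family (\<lambda>i::nat. (\<lambda>y. x [^] i \<otimes> y) ` E)"
  proof (rule ccontr)
    assume "\<not> disjoint_family (\<lambda>i::nat. (\<lambda>y. x [^] i \<otimes> y) ` E)"
    then obtain i j :: nat where "i \<noteq> j" and "(\<lambda>y. x [^] i \<otimes> y) ` E \<inter> (\<lambda>y. x [^] j \<otimes> y) ` E \<noteq> {}"
      unfolding disjoint_family_on_def by blast
    then obtain i j where ij: "i < j" "(\<lambda>y. x [^] (i::nat) \<otimes> y) ` E \<inter> (\<lambda>y. x [^] (j::nat) \<otimes> y) ` E \<noteq> {}"
      by (metis Int_commute nat_neq_iff)
    then obtain a b where ab: "a \<in> E" "b \<in> E" "x [^] i \<otimes> a = x [^] j \<otimes> b"
      by auto
    have abG: "a \<in> carrier G" "b \<in> carrier G"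
      using ab(1,2) EG by auto
    have "x [^] j = x [^] i \<otimes> x [^] (j - i)"
      using ij(1) x by (simp add: nat_pow_mult)
    then have "a = x [^] (j - i) \<otimes> b"
      using ab(3) x abG by (simp add: m_assoc)
    then have "x [^] (j - i) = a \<otimes> inv b"
      using abG x by (simp add: m_assoc)
    also have "\<dots> \<in> E"
      using ab E_sub by (simp add: subgroup.m_closed subgroup.m_inv_closed)
    finally show False
      using none ij(1) unfolding E_def by (metis IntD2 zero_less_diff)
  qed
  then have E_null: "emeasure \<mu>H E = 0"
    using subgroup_pow_closed[OF mono(1,3)]
    by (intro haar_measure_null_of_disjoint_translates[OF H E_sets, of "\<lambda>i. x [^] i"]) auto
  have "commuting_prob G ?H \<mu>H \<mu>G \<le> (\<integral>\<^sup>+ h. indicator E h \<partial>\<mu>H)"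
    unfolding commuting_prob_def
  proof (rule nn_integral_mono)
    fix h assume "h \<in> space \<mu>H"
    then have h: "h \<in> ?H"
      by (simp add: haar_measureD(2)[OF H])
    show "emeasure \<mu>G {g \<in> carrier G. h \<otimes> g = g \<otimes> h} \<le> indicator E h"
    proof (cases "h \<in> FC")
      case True
      then show ?thesis
        using h emeasure_space[of \<mu>G "{g \<in> carrier G. h \<otimes> g = g \<otimes> h}"] haar_measureD(1,2)[OF G]
        by (simp add: E_def)
    next
      case False
      then show ?thesis
        using haar_measure_centralizer_null[OF G] h HG by (auto simp: centralizer_def)
    qed
  qed
  also have "\<dots> = 0"
    using E_sets E_null by simp
  finally show False
    using pos by simp
qed

lemma commuting_prob_pos_of_pow_centralizes:
  assumes x: "x \<in> carrier G" and N: "openin T N" "subgroup N G"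
    and n: "0 < n" "\<And>t. t \<in> N \<Longrightarrow> x [^] (n::nat) \<otimes> t = t \<otimes> x [^] n"
    and H: "haar_measure G T (monothetic G T x) \<mu>H" and G: "haar_measure G T (carrier G) \<mu>G"
  shows "0 < commuting_prob G (monothetic G T x) \<mu>H \<mu>G"
proof -
  let ?H = "monothetic G T x"
  note mono = monothetic_subgroup[OF x]
  have HG: "?H \<subseteq> carrier G"
    by (rule subgroup.subset[OF mono(1)])
  have NG: "N \<subseteq> carrier G"
    by (rule subgroup.subset[OF N(2)])
  have sub: "subtopology T (carrier G) = T"
    by (simp flip: topspace_eq)
  have open_sets: "U \<in> sets \<mu>G" if "openin T U" for U
    using openin_imp_sets_borel_of[OF that] by (simp add: haar_measureD(3)[OF G] sub)
  have N_nbhd: "one_nbhd N"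
    using N subgroup.one_closed by (simp add: one_nbhd_def)
  obtain R where R: "finite R" "R \<subseteq> carrier G" "carrier G \<subseteq> (\<Union>s\<in>R. (\<lambda>x. s \<otimes> x) ` N)"
    using translate_cover_exists[OF N_nbhd subset_refl] by (auto simp: translate_cover_def)
  then have N_pos: "0 < emeasure \<mu>G N"
    using N(1) openin_translate open_sets by (intro haar_measure_pos_of_finite_cover[OF G]) auto
  define M where "M = \<Inter>(insert ?H (centralizer ` N))"
  have M_sub: "subgroup M G"
    unfolding M_def using mono(1) subgroup_centralizer NG by (intro subgroups_Inter) auto
  have M_closed: "closedin T M"
    unfolding M_def using mono(2) closedin_centralizer NG by (intro closedin_Inter) auto
  have MH: "M \<subseteq> ?H"
    by (auto simp: M_def)
  have MG: "M \<subseteq> carrier G"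
    using MH HG by blast
  have M_sets: "M \<in> sets \<mu>H"
    by (rule haar_measure_closed_sets[OF H M_closed MH])
  have powM: "x [^] n \<in> M"
    using subgroup_pow_closed[OF mono(1,3)] n(2) NG x by (auto simp: M_def centralizer_def)
  let ?S = "(\<lambda>i. x [^] i) ` {..<n}"
  have S: "?S \<subseteq> carrier G"
    using x by auto
  have translates_closed: "closedin T (\<Union>s\<in>?S. (\<lambda>y. s \<otimes> y) ` M)"
    using S closedin_translate M_closed by (intro closedin_Union) auto
  have translate_sets: "(\<lambda>y. s \<otimes> y) ` M \<in> sets \<mu>H" if "s \<in> ?S" for s
  proof (rule haar_measure_closed_sets[OF H])
    show "closedin T ((\<lambda>y. s \<otimes> y) ` M)"
      using that S closedin_translate M_closed by blast
    have "s \<in> ?H"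
      using that subgroup_pow_closed[OF mono(1,3)] by auto
    then show "(\<lambda>y. s \<otimes> y) ` M \<subseteq> ?H"
      using MH subgroup.m_closed[OF mono(1)] by blast
  qed
  have "generate G {x} \<subseteq> (\<Union>s\<in>?S. (\<lambda>y. s \<otimes> y) ` M)"
  proof
    fix y assume "y \<in> generate G {x}"
    then obtain k :: int where k: "y = x [^] k"
      using generate_pow[OF x] by auto
    define i where "i = nat (k mod int n)"
    have i: "i < n" "int i = k mod int n"
      using n(1) by (auto simp: i_def nat_less_iff)
    have "y = x [^] (int i + int n * (k div int n))"
      using k i(2) by simp
    also have "\<dots> = x [^] i \<otimes> (x [^] n) [^] (k div int n)"
      using x by (simp add: int_pow_mult int_pow_int flip: int_pow_pow)
    finally have "y = x [^] i \<otimes> (x [^] n) [^] (k div int n)" .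
    moreover have "(x [^] n) [^] (k div int n) \<in> M"
      using subgroup_int_pow_closed[OF M_sub powM] .
    ultimately show "y \<in> (\<Union>s\<in>?S. (\<lambda>y. s \<otimes> y) ` M)"
      using i(1) by blast
  qed
  then have "?H \<subseteq> (\<Union>s\<in>?S. (\<lambda>y. s \<otimes> y) ` M)"
    unfolding monothetic_def by (rule closure_of_minimal[OF _ translates_closed])
  then have M_pos: "0 < emeasure \<mu>H M"
    using translate_sets subgroup_pow_closed[OF mono(1,3)]
    by (intro haar_measure_pos_of_finite_cover[OF H M_sets, of ?S]) auto
  have "0 < emeasure \<mu>G N * emeasure \<mu>H M"
    using N_pos M_pos by (simp add: ennreal_zero_less_mult_iff)
  also have "\<dots> = (\<integral>\<^sup>+ h. emeasure \<mu>G N * indicator M h \<partial>\<mu>H)"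
    using M_sets by (simp add: nn_integral_cmult_indicator)
  also have "\<dots> \<le> commuting_prob G ?H \<mu>H \<mu>G"
    unfolding commuting_prob_def
  proof (rule nn_integral_mono)
    fix h assume "h \<in> space \<mu>H"
    show "emeasure \<mu>G N * indicator M h \<le> emeasure \<mu>G {g \<in> carrier G. h \<otimes> g = g \<otimes> h}"
    proof (cases "h \<in> M")
      case True
      have "N \<subseteq> centralizer h"
        using True NG by (auto simp: M_def centralizer_def)
      moreover have "centralizer h \<in> sets \<mu>G"
        using True MG closedin_centralizer by (intro haar_measure_closed_sets[OF G]) (auto simp: centralizer_def)
      ultimately have "emeasure \<mu>G N \<le> emeasure \<mu>G (centralizer h)"
        by (rule emeasure_mono)
      then show ?thesis
        using True by (simp add: centralizer_def)
    qed simp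
  qed
  finally show ?thesis .
qed

end

lemma (in group) normal_centralizer_in:
  assumes K: "subgroup K G" and N: "N \<lhd> G"
  shows "centralizer_in G K N \<lhd> G\<lparr>carrier := K\<rparr>"
proof -
  interpret K: group "G\<lparr>carrier := K\<rparr>"
    by (rule subgroup.subgroup_is_group[OF K group_axioms])
  have KG: "K \<subseteq> carrier G"
    by (rule subgroup.subset[OF K])
  have NG: "N \<subseteq> carrier G"
    using normal_imp_subgroup[OF N] subgroup.subset by blast
  let ?C = "centralizer_in G K N"
  have C: "c \<in> carrier G" "c \<in> K" if "c \<in> ?C" for c
    using that KG by (auto simp: centralizer_in_def)
  have comm: "c \<otimes> t = t \<otimes> c" if "c \<in> ?C" "t \<in> N" for c t
    using that by (simp add: centralizer_in_def)
  have conj: "x \<otimes> c \<otimes> inv x \<in> ?C" if x: "x \<in> K" and c: "c \<in> ?C" for x c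
  proof -
    have xG: "x \<in> carrier G"
      using x KG by blast
    have "x \<otimes> c \<otimes> inv x \<otimes> t = t \<otimes> (x \<otimes> c \<otimes> inv x)" if t: "t \<in> N" for t
    proof -
      have tG: "t \<in> carrier G"
        using t NG by blast
      have "inv x \<otimes> t \<otimes> x \<in> N"
        using normal.inv_op_closed1[OF N xG t] .
      then have "c \<otimes> (inv x \<otimes> t \<otimes> x) = (inv x \<otimes> t \<otimes> x) \<otimes> c"
        by (rule comm[OF c])
      then have "x \<otimes> (c \<otimes> (inv x \<otimes> t \<otimes> x)) \<otimes> inv x = x \<otimes> ((inv x \<otimes> t \<otimes> x) \<otimes> c) \<otimes> inv x"
        by simp
      moreover have "x \<otimes> (c \<otimes> (inv x \<otimes> t \<otimes> x)) \<otimes> inv x = x \<otimes> c \<otimes> inv x \<otimes> t"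
        using xG tG C(1)[OF c] by (simp add: m_assoc)
      moreover have "x \<otimes> ((inv x \<otimes> t \<otimes> x) \<otimes> c) \<otimes> inv x = t \<otimes> (x \<otimes> c \<otimes> inv x)"
        using xG tG C(1)[OF c] by (simp add: m_assoc[symmetric])
      ultimately show ?thesis by simp
    qed
    then show ?thesis
      using K x C(2)[OF c] by (simp add: centralizer_in_def subgroup.m_closed subgroup.m_inv_closed)
  qed
  have "subgroup ?C (G\<lparr>carrier := K\<rparr>)"
  proof (rule K.subgroupI)
    show "?C \<subseteq> carrier (G\<lparr>carrier := K\<rparr>)"
      by (auto simp: centralizer_in_def)
    show "?C \<noteq> {}"
      using subgroup.one_closed[OF K] NG by (auto simp: centralizer_in_def intro!: exI[of _ \<one>])
    show "inv\<^bsub>G\<lparr>carrier := K\<rparr>\<^esub> c \<in> ?C" if c: "c \<in> ?C" for c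
    proof -
      have "inv c \<otimes> t = t \<otimes> inv c" if t: "t \<in> N" for t
      proof -
        have tG: "t \<in> carrier G"
          using t NG by blast
        have "inv c \<otimes> (c \<otimes> t) \<otimes> inv c = inv c \<otimes> (t \<otimes> c) \<otimes> inv c"
          using comm[OF c t] by simp
        moreover have "inv c \<otimes> (c \<otimes> t) \<otimes> inv c = t \<otimes> inv c"
          using tG C(1)[OF c] by (simp add: m_assoc[symmetric])
        moreover have "inv c \<otimes> (t \<otimes> c) \<otimes> inv c = inv c \<otimes> t"
          using tG C(1)[OF c] by (simp add: m_assoc)
        ultimately show ?thesis by simp
      qed
      then show ?thesis
        using C(2)[OF c] K by (simp add: centralizer_in_def m_inv_consistent subgroup.m_inv_closed)
    qed
    show "c \<otimes>\<^bsub>G\<lparr>carrier := K\<rparr>\<^esub> d \<in> ?C" if c: "c \<in> ?C" and d: "d \<in> ?C" for c d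
    proof -
      have "c \<otimes> d \<otimes> t = t \<otimes> (c \<otimes> d)" if t: "t \<in> N" for t
      proof -
        have tG: "t \<in> carrier G"
          using t NG by blast
        have "c \<otimes> d \<otimes> t = c \<otimes> (t \<otimes> d)"
          using tG C(1)[OF c] C(1)[OF d] comm[OF d t] by (simp add: m_assoc)
        also have "\<dots> = t \<otimes> c \<otimes> d"
          using tG C(1)[OF c] C(1)[OF d] comm[OF c t] by (simp add: m_assoc[symmetric])
        finally show ?thesis
          using tG C(1)[OF c] C(1)[OF d] by (simp add: m_assoc)
      qed
      then show ?thesis
        using C(2)[OF c] C(2)[OF d] K by (simp add: centralizer_in_def subgroup.m_closed)
    qed
  qed
  then show ?thesis
    unfolding K.normal_inv_iff using conj K by (simp add: m_inv_consistent)
qed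

lemma (in group) torsion_quotient_centralizer_iff:
  assumes K: "subgroup K G" and N: "N \<lhd> G"
  shows "torsion_group ((G\<lparr>carrier := K\<rparr>) Mod (centralizer_in G K N)) \<longleftrightarrow>
    (\<forall>x\<in>K. \<exists>n>0. \<forall>t\<in>N. x [^] (n::nat) \<otimes> t = t \<otimes> x [^] n)"
proof -
  let ?K = "G\<lparr>carrier := K\<rparr>" and ?C = "centralizer_in G K N"
  interpret C: normal ?C ?K
    by (rule normal_centralizer_in[OF assms])
  have pow_eq: "(?C #>\<^bsub>?K\<^esub> x) [^]\<^bsub>?K Mod ?C\<^esub> n = \<one>\<^bsub>?K Mod ?C\<^esub> \<longleftrightarrow>
      (\<forall>t\<in>N. x [^] n \<otimes> t = t \<otimes> x [^] n)" if x: "x \<in> K" for x and n :: nat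
  proof -
    have "(?C #>\<^bsub>?K\<^esub> x) [^]\<^bsub>?K Mod ?C\<^esub> n = ?C #>\<^bsub>?K\<^esub> (x [^] n)"
      using C.FactGroup_pow[of x n] x by (simp add: nat_pow_consistent[symmetric])
    moreover have "?C #>\<^bsub>?K\<^esub> (x [^] n) = ?C \<longleftrightarrow> x [^] n \<in> ?C"
      using C.coset_join1[of ?C "x [^] n"] C.coset_join2[of "x [^] n" ?C] C.subgroup_axioms
        subgroup_pow_closed[OF K x, of n] by auto
    ultimately show ?thesis
      using subgroup_pow_closed[OF K x, of n] by (simp add: FactGroup_def centralizer_in_def)
  qed
  have carr: "carrier (?K Mod ?C) = (\<lambda>x. ?C #>\<^bsub>?K\<^esub> x) ` K"
    by (auto simp: FactGroup_def RCOSETS_def)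
  have "torsion_group (?K Mod ?C) \<longleftrightarrow>
      (\<forall>x\<in>K. \<exists>n::nat. n > 0 \<and> (?C #>\<^bsub>?K\<^esub> x) [^]\<^bsub>?K Mod ?C\<^esub> n = \<one>\<^bsub>?K Mod ?C\<^esub>)"
    by (simp only: torsion_group_def carr ball_simps)
  also have "\<dots> \<longleftrightarrow> (\<forall>x\<in>K. \<exists>n>0. \<forall>t\<in>N. x [^] (n::nat) \<otimes> t = t \<otimes> x [^] n)"
    by (intro ball_cong refl ex_cong1 conj_cong pow_eq)
  finally show ?thesis .
qed

theorem theorem1p1:
  fixes G :: "('a, 'b) monoid_scheme" and T :: "'a topology" and K :: "'a set"
  assumes "compact_group G T"
    and "subgroup K G"
    and "closedin T K"
  shows "(\<forall>x\<in>K. \<forall>\<mu>H \<mu>G. haar_measure G T (monothetic G T x) \<mu>H \<longrightarrow> haar_measure G T (carrier G) \<mu>G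
            \<longrightarrow> commuting_prob G (monothetic G T x) \<mu>H \<mu>G > 0)
     \<longleftrightarrow> (\<exists>N. openin T N \<and> N \<lhd> G
            \<and> torsion_group ((G\<lparr>carrier := K\<rparr>) Mod (centralizer_in G K N)))"
    (is "?L \<longleftrightarrow> ?R")
proof -
  interpret compact_topological_group G T
    by unfold_locales (rule assms(1))
  have KG: "x \<in> carrier G" if "x \<in> K" for x
    using that subgroup.subset[OF assms(2)] by blast
  show ?thesis
  proof
    assume L: ?L
    have "\<exists>m>0. x [^]\<^bsub>G\<^esub> (m::nat) \<in> FC" if x: "x \<in> K" for x
    proof -
      obtain \<mu>H \<mu>G where haar: "haar_measure G T (monothetic G T x) \<mu>H"
          "haar_measure G T (carrier G) \<mu>G"
        using haar_measure_subgroup_exists[OF monothetic_subgroup(1,2)[OF KG[OF x]]]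
          haar_measure_exists by (elim exE)
      then have "0 < commuting_prob G (monothetic G T x) \<mu>H \<mu>G"
        using L x by simp
      then show ?thesis
        by (rule pow_FC_of_commuting_prob_pos[OF KG[OF x] haar])
    qed
    then obtain N where N: "openin T N" "N \<lhd> G"
      "\<And>x. x \<in> K \<Longrightarrow> \<exists>n>0. \<forall>t\<in>N. x [^]\<^bsub>G\<^esub> (n::nat) \<otimes>\<^bsub>G\<^esub> t = t \<otimes>\<^bsub>G\<^esub> x [^]\<^bsub>G\<^esub> n"
      using open_normal_of_FC_powers[OF assms(2,3)] by metis
    have "torsion_group ((G\<lparr>carrier := K\<rparr>) Mod (centralizer_in G K N))"
      unfolding torsion_quotient_centralizer_iff[OF assms(2) N(2)] using N(3) by (rule ballI)
    then show ?R
      using N(1,2) by blast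
  next
    assume ?R
    then obtain N where N: "openin T N" "N \<lhd> G"
      and tors: "torsion_group ((G\<lparr>carrier := K\<rparr>) Mod (centralizer_in G K N))"
      by blast
    note tors = tors[unfolded torsion_quotient_centralizer_iff[OF assms(2) N(2)]]
    show ?L
    proof (intro ballI allI impI)
      fix x \<mu>H \<mu>G
      assume x: "x \<in> K" and haar: "haar_measure G T (monothetic G T x) \<mu>H"
        "haar_measure G T (carrier G) \<mu>G"
      obtain n :: nat where n: "0 < n" "\<forall>t\<in>N. x [^]\<^bsub>G\<^esub> n \<otimes>\<^bsub>G\<^esub> t = t \<otimes>\<^bsub>G\<^esub> x [^]\<^bsub>G\<^esub> n"
        using bspec[OF tors x] by (elim exE conjE)
      show "0 < commuting_prob G (monothetic G T x) \<mu>H \<mu>G"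
        by (rule commuting_prob_pos_of_pow_centralizes[OF KG[OF x] N(1) normal_imp_subgroup[OF N(2)]
              n(1) bspec[OF n(2)] haar])
    qed
  qed
qed

end
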